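(* Let $n\in\{1,2,3,\dots\}$ and $\alpha\in(n-\tfrac12,n+\tfrac12)$. Let $u(x;\alpha+j)$, $j=0,1,2,\dots$, be either the sequence of quasi-Ablowitz-Segur solutions $u_{\mathrm{qAS}}(x;\alpha+j)$ with parameters $k_{\alpha+j}=(-1)^jk_\alpha$, where $k_\alpha\in(-|\cos\pi\alpha|,|\cos\pi\alpha|)$ is real, or the sequence of quasi-Hastings-McLeod solutions $u_{\mathrm{qHM}}(x;\alpha+j)$; in both cases consecutive solutions are related by the Bäcklund transformation. Let $p_{i,\pm1}(\alpha)$ denote the $i$-th real pole of $u(x;\alpha)$, counted in increasing order starting from the negative real axis, where the subscript $\pm1$ indicates that the residue at this pole is $+1$ or $-1$ (and similarly for $p_{i,\pm1}(\alpha+j)$ and $u(x;\alpha+j)$). Then: (a) The residue at the smallest real pole is $+1$. Moreover, the smallest pole is strictly decreasing with respect to $\alpha$, i.e. $$p_{1,+1}(\alpha)>p_{1,+1}(\alpha+1)>p_{1,+1}(\alpha+2)>\cdots.$$ (b) The poles with residue $+1$ and $-1$ interlace on the real axis, that is, $$p_{1,+1}(\alpha)<p_{2,-1}(\alpha)<\cdots<p_{n,+1}(\alpha)\ \text{ if $n$ is odd},\qquad p_{1,+1}(\alpha)<p_{2,-1}(\alpha)<\cdots<p_{n,-1}(\alpha)\ \text{ if $n$ is even}.$$ (c) All poles of $u(x;\alpha)$ with residue $+1$ become poles of $u(x;\alpha+1)$ with residue $-1$ via the Bäcklund transformation, i.e. $p_{i+1,-1}(\alpha+1)=p_{i,+1}(\alpha)$;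 while all poles of $u(x;\alpha)$ with residue $-1$ are regular points of $u(x;\alpha+1)$. (d) The residue at the largest real pole is $+1$ when $n$ is odd and $-1$ when $n$ is even. The largest poles are increasing with respect to $\alpha$: $$p_{n,+1}(\alpha)=p_{n+1,-1}(\alpha+1)<p_{n+2,+1}(\alpha+2)=p_{n+3,-1}(\alpha+3)<\cdots\quad\text{if $n$ is odd},$$ $$p_{n,-1}(\alpha)<p_{n+1,+1}(\alpha+1)=p_{n+2,-1}(\alpha+2)<\cdots\quad\text{if $n$ is even}.$$
   Context: The Painlevé II equation (PII) with real parameter $\alpha$ is $u''(x)=2u(x)^3+xu(x)-\alpha$. Its solutions extend to meromorphic functions on $\mathbb{C}$, all of whose poles are simple with residue $\pm1$; poles on the real axis are called real poles. $\mathrm{Ai}$ is the Airy function. The Bäcklund transformation sends a solution $u(x;\alpha)$ of PII with parameter $\alpha$ to the solution of PII with parameter $\alpha+1$ $$u(x;\alpha+1)=-u(x;\alpha)+\frac{2\alpha+1}{2u^2(x;\alpha)-2u'(x;\alpha)+x}.$$ It sends the qAS solution (defined below) with parameters $(\alpha,k_\alpha)$ to the one with parameters $(\alpha+1,-k_\alpha)$, and the qHM solution (defined below) with parameter $\alpha$ to the one with parameter $\alpha+1$. $B(x;\alpha)$ denotes a function (depending on $\alpha$ only) with the asymptotic expansion, as $x\to+\infty$, $$B(x;\alpha)\sim\frac{\alpha}{x}\sum_{m=0}^\infty\frac{a_m}{x^{3m}},\qquad a_0=1,\qquad a_{m+1}=(3m+1)(3m+2)a_m-2\alpha^2\sum_{\substack{i,j,l\ge0\\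 i+j+l=m}}a_ia_ja_l .$$ Quasi-Ablowitz-Segur (qAS) solutions: for $\alpha\in(n-\frac12,n+\frac12)$, $n\in\{1,2,\dots\}$, and real $k_\alpha\in(-|\cos\pi\alpha|,|\cos\pi\alpha|)$, $u_{\mathrm{qAS}}(x;\alpha)$ is the real solution of PII such that $$u_{\mathrm{qAS}}(x;\alpha)=B(x;\alpha)+k_\alpha\,\mathrm{Ai}(x)(1+O(x^{-3/4})),\quad x\to+\infty,$$ $$u_{\mathrm{qAS}}(x;\alpha)=\frac{d}{(-x)^{1/4}}\cos\Big\{\tfrac23(-x)^{3/2}-\tfrac34d^2\ln(-x)+\phi\Big\}+O(|x|^{-1}),\quad x\to-\infty,$$ where $$d=\frac1{\sqrt\pi}\sqrt{-\ln(\cos^2(\pi\alpha)-k_\alpha^2)},\qquad \phi=-\tfrac32d^2\ln2+\arg\Gamma\big(\tfrac12id^2\big)-\tfrac\pi4-\arg(-\sin\pi\alpha-k_\alpha i)$$ (if $d=0$ the cosine term is absent). Quasi-Hastings-McLeod (qHM) solution: for $\alpha\in(n-\frac12,n+\frac12)$, $n\in\{1,2,\dots\}$, $u_{\mathrm{qHM}}(x;\alpha)$ is the real solution of PII such that $$u_{\mathrm{qHM}}(x;\alpha)=B(x;\alpha)-\cos(\pi\alpha)\,\mathrm{Ai}(x)(1+O(x^{-3/4})),\quad x\to+\infty,$$ $$u_{\mathrm{qHM}}(x;\alpha)=-\sqrt{\frac{-x}{2}}-\frac{\alpha}{2x}+O((-x)^{-3/2}),\quad x\to-\infty .$$ For $\alpha\in(n-\frac12,n+\frac12)$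 these solutions have exactly $n$ real poles, which is the indexing used in the claim. *)

theory Defs
  imports
    "HOL-Complex_Analysis.Complex_Analysis"
    "HOL-Library.Landau_Symbols"
begin

text \<open>The integral defining the Airy function on the real line is only conditionally convergent; the
  Henstock--Kurzweil integral over the unbounded interval is the limit of the integrals over
  \<open>{0..R}\<close> as \<open>R\<close> tends to infinity.\<close>

definition airy_Ai :: "real \<Rightarrow> real" where
  "airy_Ai x = 1 / pi * integral {0..} (\<lambda>t. cos (t ^ 3 / 3 + x * t))"


text \<open>A solution is represented by its meromorphic continuation to the complex plane.
  By \<^const>\<open>nicely_meromorphic_on\<close> it is analytic at every point that is not a pole.\<close>

definition PII_solution :: "real \<Rightarrow> (complex \<Rightarrow> complex) \<Rightarrow> bool" where
  "PII_solution \<alpha> u \<longleftrightarrow>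
     u nicely_meromorphic_on UNIV \<and>
     (\<forall>z. \<not> is_pole u z \<longrightarrow> deriv (deriv u) z = 2 * u z ^ 3 + z * u z - of_real \<alpha>)"

definition real_PII_solution :: "real \<Rightarrow> (complex \<Rightarrow> complex) \<Rightarrow> bool" where
  "real_PII_solution \<alpha> u \<longleftrightarrow>
     PII_solution \<alpha> u \<and> (\<forall>x::real. \<not> is_pole u (of_real x) \<longrightarrow> u (of_real x) \<in> \<real>)"

text \<open>The identity is one between meromorphic functions. The points excluded here are exactly those
  at which the right-hand side cannot be evaluated pointwise.\<close>

definition Backlund_related ::
    "real \<Rightarrow> (complex \<Rightarrow> complex) \<Rightarrow> (complex \<Rightarrow> complex) \<Rightarrow> bool" where
  "Backlund_related \<alpha> u v \<longleftrightarrow>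
     (\<forall>z. \<not> is_pole u z \<and> 2 * u z ^ 2 - 2 * deriv u z + z \<noteq> 0 \<longrightarrow>
        v z = - u z + of_real (2 * \<alpha> + 1) / (2 * u z ^ 2 - 2 * deriv u z + z))"


fun B_coeff :: "real \<Rightarrow> nat \<Rightarrow> real" where
  "B_coeff \<alpha> 0 = 1"
| "B_coeff \<alpha> (Suc m) =
     (3 * real m + 1) * (3 * real m + 2) * B_coeff \<alpha> m
     - 2 * \<alpha>\<^sup>2 * (\<Sum>(i, j, l) \<in> {(i, j, l). i + j + l = m}. B_coeff \<alpha> i * B_coeff \<alpha> j * B_coeff \<alpha> l)"

text \<open>Poincare asymptotic expansion with respect to the scale \<open>1 / x ^ (3 * m + 1)\<close>.\<close>

definition has_B_expansion :: "real \<Rightarrow> (real \<Rightarrow> real) \<Rightarrow> bool" where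
  "has_B_expansion \<alpha> b \<longleftrightarrow>
     (\<forall>N. (\<lambda>x. b x - \<alpha> / x * (\<Sum>m\<le>N. B_coeff \<alpha> m / x ^ (3 * m)))
            \<in> o[at_top](\<lambda>x. 1 / x ^ (3 * N + 1)))"

definition right_asymptotics ::
    "(real \<Rightarrow> real) \<Rightarrow> real \<Rightarrow> (complex \<Rightarrow> complex) \<Rightarrow> bool" where
  "right_asymptotics b k u \<longleftrightarrow>
     (\<exists>r \<in> O[at_top](\<lambda>x. x powr (-3/4)).
        \<forall>\<^sub>F x in at_top. Re (u (of_real x)) = b x + k * airy_Ai x * (1 + r x))"


definition qAS_d :: "real \<Rightarrow> real \<Rightarrow> real" where
  "qAS_d \<alpha> k = 1 / sqrt pi * sqrt (- ln ((cos (pi * \<alpha>))\<^sup>2 - k\<^sup>2))"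

text \<open>If \<open>qAS_d \<alpha> k = 0\<close>, the value of the phase is irrelevant, since the amplitude of the cosine in
  \<open>qAS_solution\<close> vanishes.\<close>

definition qAS_phi :: "real \<Rightarrow> real \<Rightarrow> real" where
  "qAS_phi \<alpha> k =
     - 3/2 * (qAS_d \<alpha> k)\<^sup>2 * ln 2
     + Arg (Gamma (\<i> * of_real ((qAS_d \<alpha> k)\<^sup>2) / 2))
     - pi / 4
     - Arg (- of_real (sin (pi * \<alpha>)) - of_real k * \<i>)"

definition qAS_solution ::
    "(real \<Rightarrow> real) \<Rightarrow> real \<Rightarrow> real \<Rightarrow> (complex \<Rightarrow> complex) \<Rightarrow> bool" where
  "qAS_solution b \<alpha> k u \<longleftrightarrow>
     real_PII_solution \<alpha> u \<and>
     right_asymptotics b k u \<and>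
     (\<lambda>x. Re (u (of_real x))
          - qAS_d \<alpha> k / (- x) powr (1/4)
            * cos (2/3 * (- x) powr (3/2) - 3/4 * (qAS_d \<alpha> k)\<^sup>2 * ln (- x) + qAS_phi \<alpha> k))
       \<in> O[at_bot](\<lambda>x. 1 / \<bar>x\<bar>)"

definition qHM_solution ::
    "(real \<Rightarrow> real) \<Rightarrow> real \<Rightarrow> (complex \<Rightarrow> complex) \<Rightarrow> bool" where
  "qHM_solution b \<alpha> u \<longleftrightarrow>
     real_PII_solution \<alpha> u \<and>
     right_asymptotics b (- cos (pi * \<alpha>)) u \<and>
     (\<lambda>x. Re (u (of_real x)) - (- sqrt (- x / 2) - \<alpha> / (2 * x)))
       \<in> O[at_bot](\<lambda>x. (- x) powr (-3/2))"


definition real_poles :: "(complex \<Rightarrow> complex) \<Rightarrow> real set" where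
  "real_poles u = {x. is_pole u (of_real x)}"

text \<open>The \<open>i\<close>-th real pole in increasing order, counted from \<open>i = 1\<close>; meaningful only if
  \<open>real_poles u\<close> is finite and \<open>1 \<le> i \<le> card (real_poles u)\<close>.\<close>

definition nth_real_pole :: "(complex \<Rightarrow> complex) \<Rightarrow> nat \<Rightarrow> real" where
  "nth_real_pole u i = sorted_list_of_set (real_poles u) ! (i - 1)"

text \<open>The residue of \<open>u\<close> at its \<open>i\<close>-th real pole, i.e. the second subscript of \<open>p\<close>
  in the notation with \<open>p\<close> indexed by \<open>i, \<plusminus>1\<close>.\<close>

definition nth_real_residue :: "(complex \<Rightarrow> complex) \<Rightarrow> nat \<Rightarrow> complex" where
  "nth_real_residue u i = residue u (of_real (nth_real_pole u i))"

end

theory Submission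
  imports Defs
begin

text \<open>
Everything is read off from one real function. For a real solution \<open>u\<close> with parameter \<open>\<alpha>\<close> let
\<open>R = 2 u^2 + 2 u' + x\<close>, the defect of \<open>u\<close> in the Riccati equation \<open>u' = - u^2 - x / 2\<close> (the one whose
solutions are logarithmic derivatives of Airy functions). Painleve II gives the linear equation
\<open>R' = 2 u R - (2 \<alpha> - 1)\<close>, and for \<open>\<alpha> > 1 / 2\<close> this fixes how \<open>R\<close> can change its sign along the real
line: a pole of \<open>u\<close> with residue \<open>1\<close> is a zero of \<open>R\<close> with an upward crossing, a pole with residue
\<open>-1\<close> is a double pole of \<open>R\<close> with \<open>R \<rightarrow> +\<infinity>\<close> on both sides, and every other zero of \<open>R\<close> is a downward
crossing. Between these events \<open>R\<close> has constant sign.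

The same \<open>R\<close> is the denominator of the inverse Backlund transformation
\<open>w = - u + (2 \<alpha> - 1) / R\<close>, which lowers the parameter by one. Computing the limit of \<open>(z - p) w z\<close> at
each kind of point shows that the poles of \<open>w\<close> with residue \<open>1\<close> are the poles of \<open>u\<close> with residue \<open>-1\<close>,
that the poles of \<open>w\<close> with residue \<open>-1\<close> are the zeros of \<open>R\<close> at which \<open>u\<close> is regular, and that \<open>w\<close> is
regular elsewhere. A forward Backlund step from \<open>u\<close> to \<open>v\<close> is inverted by this transformation, because
the denominator of the forward step at \<open>u\<close> equals the Riccati defect of \<open>v\<close>. This already gives how
residues change from one solution to the next.

Near \<open>+\<infinity>\<close> the defect is positive, as otherwise \<open>u' < - (1 + u^2)\<close> would force a pole. Near \<open>-\<infinity>\<close> it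
is negative as soon as \<open>u\<close> is bounded above there: a positive defect would make \<open>u\<close> negative, and then
\<open>R'' \<ge> R^2\<close> would force a pole again. In both families the asymptotics at \<open>-\<infinity>\<close> give such a bound: one
kind of solution decays there, the other one tends to \<open>-\<infinity>\<close>.

The residues of \<open>u\<close> alternate, beginning with \<open>1\<close>, if \<open>u\<close> has \<open>m\<close> real poles and \<open>\<alpha> > m - 1 / 2\<close>. This
is an induction on \<open>m\<close> (\<open>real_poles_alternate\<close>): the crossings of \<open>R\<close> show that \<open>w\<close> has exactly one real
pole less than \<open>u\<close>; negativity of the defect near \<open>-\<infinity>\<close> is inherited by \<open>w\<close>, and the alternation of the
poles of \<open>w\<close> lifts to \<open>u\<close> (\<open>alternating_lift\<close>). Applied to all members of the sequence, together with the
description of how poles move, this determines the positions of all poles relative to each other.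
\<close>


section \<open>Analytic functions near a point\<close>


lemma eventually_nhds_analytic:
  fixes f :: "complex \<Rightarrow> complex"
  assumes "f analytic_on {z}"
  shows "\<forall>\<^sub>F y in nhds z. f analytic_on {y}"
proof -
  obtain S where "open S" "z \<in> S" "f holomorphic_on S"
    using assms analytic_at by blast
  then show ?thesis
    by (auto intro!: eventually_nhds_in_open[THEN eventually_mono] simp: holomorphic_on_imp_analytic_at)
qed

lemma eventually_at_eventually_nhds:
  fixes z :: "'a :: t1_space"
  assumes "\<forall>\<^sub>F y in at z. P y"
  shows "\<forall>\<^sub>F y in at z. \<forall>\<^sub>F x in nhds y. P x"
proof -
  obtain S where S: "open S" "z \<in> S" "\<And>y. y \<in> S \<Longrightarrow> y \<noteq> z \<Longrightarrow> P y"
    using assms unfolding eventually_at_topological by blast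
  have "\<forall>\<^sub>F y in at z. y \<in> S - {z}"
    by (rule eventually_at_in_open) (use S in auto)
  then show ?thesis
  proof eventually_elim
    case (elim y)
    have "\<forall>\<^sub>F x in nhds y. x \<in> S - {z}"
      by (rule eventually_nhds_in_open) (use S elim in auto)
    then show ?case
      by eventually_elim (use S in auto)
  qed
qed

lemma eventually_at_analytic:
  fixes f :: "complex \<Rightarrow> complex"
  assumes "f analytic_on {z}"
  shows "\<forall>\<^sub>F y in at z. f analytic_on {y}"
  using eventually_nhds_analytic[OF assms] by (simp add: eventually_at_filter eventually_mono)

lemma analytic_tendsto: "f analytic_on {p} \<Longrightarrow> (f \<longlongrightarrow> f p) (at (p::complex))"
  by (simp add: analytic_at_imp_isCont isContD)

lemma eq_at_if_eventually_eq:
  fixes f g :: "complex \<Rightarrow> complex"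
  assumes "f analytic_on {p}" "g analytic_on {p}" "\<forall>\<^sub>F z in at p. f z = g z"
  shows "f p = g p"
proof -
  have "(f \<longlongrightarrow> g p) (at p)"
    using analytic_tendsto[OF assms(2)] tendsto_cong[OF assms(3)] by simp
  then show ?thesis
    using analytic_tendsto[OF assms(1)] tendsto_unique by (metis at_neq_bot)
qed

lemma analytic_factor_root:
  fixes k :: "complex \<Rightarrow> complex"
  assumes "k analytic_on {p}" "k p = 0"
  obtains g where "g analytic_on {p}" "\<forall>\<^sub>F z in nhds p. k z = (z - p) * g z"
proof -
  obtain S where S: "open S" "p \<in> S" "k holomorphic_on S"
    using assms(1) analytic_at by blast
  define g where "g z = (if z = p then deriv k p else (k z - k p) / (z - p))" for z
  have "g holomorphic_on S"
    unfolding g_def by (rule pole_lemma) (use S in \<open>auto simp: interior_open\<close>)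
  then have "g analytic_on {p}"
    using S analytic_at by blast
  moreover have "k z = (z - p) * g z" for z
    by (auto simp: g_def assms)
  ultimately show ?thesis
    using that by auto
qed

text \<open>At the singular point of an Euler type equation \<open>j k + t k' = g k - c t^(n + 1)\<close> the limit
  \<open>t \<rightarrow> 0\<close> forces \<open>k\<close> to vanish unless \<open>g p = j\<close>; dividing by \<open>t\<close> leads to an equation of the same shape
  with \<open>j\<close> raised and \<open>n\<close> lowered. Iterating finds the order of vanishing of \<open>k\<close> without power series.\<close>

lemma euler_equation_root:
  fixes k g :: "complex \<Rightarrow> complex"
  assumes k: "k analytic_on {p}" and g: "g analytic_on {p}" and ne: "g p \<noteq> of_nat j"
    and eq: "\<forall>\<^sub>F z in at p. of_nat j * k z + (z - p) * deriv k z = g z * k z - c * (z - p) ^ Suc n"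
  obtains k1 where "k1 analytic_on {p}" "\<forall>\<^sub>F z in nhds p. k z = (z - p) * k1 z"
    "\<forall>\<^sub>F z in at p. of_nat (Suc j) * k1 z + (z - p) * deriv k1 z = g z * k1 z - c * (z - p) ^ n"
proof -
  have "of_nat j * k p + (p - p) * deriv k p = g p * k p - c * (p - p) ^ Suc n"
    by (rule eq_at_if_eventually_eq[OF _ _ eq]) (intro analytic_intros k g)+
  then have "k p = 0"
    using ne by (simp add: algebra_simps)
  then obtain k1 where k1: "k1 analytic_on {p}" "\<forall>\<^sub>F z in nhds p. k z = (z - p) * k1 z"
    using analytic_factor_root[OF k] by blast
  have "\<forall>\<^sub>F z in at p. \<forall>\<^sub>F y in nhds z. k y = (y - p) * k1 y"
    using k1(2) by (intro eventually_at_eventually_nhds) (simp add: eventually_at_filter eventually_mono)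
  with eventually_at_analytic[OF k1(1)] eventually_neq_at_within[of p p] eq
  have "\<forall>\<^sub>F z in at p. of_nat (Suc j) * k1 z + (z - p) * deriv k1 z = g z * k1 z - c * (z - p) ^ n"
  proof eventually_elim
    case (elim z)
    have kz: "k z = (z - p) * k1 z"
      using elim(4) by (rule eventually_nhds_x_imp_x)
    have "deriv k z = deriv (\<lambda>y. (y - p) * k1 y) z"
      by (rule deriv_cong_ev) (use elim in auto)
    also have "\<dots> = k1 z + (z - p) * deriv k1 z"
      by (rule DERIV_imp_deriv)
        (rule derivative_eq_intros refl analytic_derivI elim | simp)+
    finally have dk: "deriv k z = k1 z + (z - p) * deriv k1 z" .
    have "(z - p) * (of_nat (Suc j) * k1 z + (z - p) * deriv k1 z) =
        of_nat j * k z + (z - p) * deriv k z"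
      unfolding dk kz of_nat_Suc by algebra
    also have "\<dots> = g z * k z - c * (z - p) ^ Suc n"
      by (rule elim(3))
    also have "\<dots> = (z - p) * (g z * k1 z - c * (z - p) ^ n)"
      unfolding kz power_Suc by algebra
    finally show ?case
      using elim(2) by simp
  qed
  with k1 show ?thesis using that by blast
qed

lemma pole_factorization:
  assumes "u meromorphic_on {p}" "is_pole u p"
  obtains h m where "h analytic_on {p}" "h p \<noteq> 0" "m \<ge> 1"
    "\<forall>\<^sub>F z in at p. u z = h z / (z - p) ^ m"
proof -
  obtain r where r: "r > 0" "u analytic_on ball p r - {p}"
    using assms(1) by (auto simp: meromorphic_at_iff isolated_singularity_at_def)
  have "zorder u p < 0 \<and> zor_poly u p p \<noteq> 0 \<and>
     (\<exists>r'>0. cball p r' \<subseteq> ball p r \<and> zor_poly u p holomorphic_on cball p r' \<and>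
       (\<forall>w\<in>cball p r' - {p}. u w = zor_poly u p w / (w - p) ^ nat (- zorder u p) \<and> zor_poly u p w \<noteq> 0))"
    by (rule zorder_exist_pole) (use r assms in \<open>auto simp: analytic_imp_holomorphic\<close>)
  then obtain r' where r': "zorder u p < 0" "zor_poly u p p \<noteq> 0" "r' > 0"
     "zor_poly u p holomorphic_on cball p r'"
     "\<And>w. w \<in> cball p r' \<Longrightarrow> w \<noteq> p \<Longrightarrow> u w = zor_poly u p w / (w - p) ^ nat (- zorder u p)"
    by auto
  have an: "zor_poly u p analytic_on {p}"
    using r' by (meson analytic_at ball_subset_cball centre_in_ball holomorphic_on_subset open_ball)
  have "\<forall>\<^sub>F w in at p. w \<in> ball p r' - {p}"
    using r' by (intro eventually_at_in_open) auto
  then have "\<forall>\<^sub>F w in at p. u w = zor_poly u p w / (w - p) ^ nat (- zorder u p)"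
    by eventually_elim (use r' in auto)
  then show ?thesis
    using that[of "zor_poly u p" "nat (- zorder u p)"] an r' by auto
qed

lemma deriv_div_power:
  assumes "h analytic_on {p}" "\<forall>\<^sub>F z in at p. f z = h z / (z - p) ^ k"
  shows "\<forall>\<^sub>F z in at p. deriv f z = ((z - p) * deriv h z - of_nat k * h z) / (z - p) ^ Suc k"
proof -
  have h: "\<forall>\<^sub>F z in at p. h analytic_on {z}"
    using eventually_nhds_analytic[OF assms(1)] by (simp add: eventually_at_filter eventually_mono)
  have "\<forall>\<^sub>F z in at p. z \<noteq> p"
    by (rule eventually_neq_at_within)
  with h eventually_at_eventually_nhds[OF assms(2)] show ?thesis
  proof eventually_elim
    case (elim z)
    have "deriv f z = deriv (\<lambda>z. h z / (z - p) ^ k) z"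
      by (rule deriv_cong_ev) (use elim in auto)
    also have "((\<lambda>z. h z / (z - p) ^ k) has_field_derivative
       ((z - p) * deriv h z - of_nat k * h z) / (z - p) ^ Suc k) (at z)"
    proof (cases k)
      case 0
      then show ?thesis using elim analytic_derivI[of h z] by simp
    next
      case (Suc l)
      show ?thesis
        apply (rule derivative_eq_intros refl analytic_derivI elim)+
        using elim apply (auto simp: Suc divide_simps)
        apply (simp add: algebra_simps)
        done
    qed
    then have "deriv (\<lambda>z. h z / (z - p) ^ k) z = ((z - p) * deriv h z - of_nat k * h z) / (z - p) ^ Suc k"
      by (rule DERIV_imp_deriv)
    finally show ?case .
  qed
qed

lemma filterlim_of_real_at: "filterlim (\<lambda>y. of_real y :: complex) (at (of_real x)) (at x)"
  by (auto simp: filterlim_at eventually_at_filter intro!: tendsto_intros)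

lemma deriv_in_Reals:
  assumes "f analytic_on {of_real x}" "\<forall>\<^sub>F y in nhds x. f (of_real y) \<in> \<real>"
  shows "deriv f (of_real x) \<in> \<real>"
proof -
  have "((\<lambda>z. (f z - f (of_real x)) / (z - of_real x)) \<longlongrightarrow> deriv f (of_real x)) (at (of_real x))"
    using analytic_derivI[OF assms(1)] by (simp add: has_field_derivative_iff)
  then have lim: "((\<lambda>y. (f (of_real y) - f (of_real x)) / (of_real y - of_real x)) \<longlongrightarrow> deriv f (of_real x)) (at x)"
    by (rule filterlim_compose[OF _ filterlim_of_real_at])
  have "f (of_real x) \<in> \<real>"
    using assms(2) by (rule eventually_nhds_x_imp_x)
  then have "\<forall>\<^sub>F y in at x. (f (of_real y) - f (of_real x)) / (of_real y - of_real x) \<in> \<real>"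
    using assms(2) by (auto simp: eventually_at_filter elim!: eventually_mono)
  from Lim_in_closed_set[OF closed_complex_Reals this _ lim] show ?thesis
    by simp
qed

section \<open>Painleve II and the Riccati defect\<close>


text \<open>The functions with vanishing defect are the Airy type solutions of Painleve II at parameter
  \<open>1 / 2\<close>. The definition is meaningful at points where \<open>u\<close> is analytic; statements about poles of \<open>u\<close>
  therefore concern punctured neighbourhoods.\<close>

definition riccati_defect :: "(complex \<Rightarrow> complex) \<Rightarrow> complex \<Rightarrow> complex" where
  "riccati_defect u z = 2 * u z ^ 2 + 2 * deriv u z + z"

lemma PII_solution_analytic_at:
  assumes "PII_solution \<alpha> u" "\<not> is_pole u z"
  shows "u analytic_on {z}"
  using assms nicely_meromorphic_on_imp_analytic_at[of u UNIV z] by (auto simp: PII_solution_def)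

lemma PII_solution_eventually_analytic:
  assumes "PII_solution \<alpha> u"
  shows "\<forall>\<^sub>F y in at z. u analytic_on {y}"
proof -
  have "u meromorphic_on {z}"
    using assms by (auto simp: PII_solution_def nicely_meromorphic_on_def intro: meromorphic_on_subset)
  then show ?thesis
    by (simp add: meromorphic_at_iff isolated_singularity_at_altdef)
qed

lemma PII_solution_eq:
  assumes "PII_solution \<alpha> u" "u analytic_on {z}"
  shows "deriv (deriv u) z = 2 * u z ^ 3 + z * u z - of_real \<alpha>"
  using assms analytic_at_imp_no_pole by (auto simp: PII_solution_def)

lemma riccati_defect_analytic:
  assumes "u analytic_on {z}"
  shows "riccati_defect u analytic_on {z}"
  unfolding riccati_defect_def using assms by (intro analytic_intros) auto

lemma deriv_riccati_defect:
  assumes "PII_solution \<alpha> u" "u analytic_on {z}"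
  shows "(riccati_defect u has_field_derivative
           2 * u z * riccati_defect u z - of_real (2 * \<alpha> - 1)) (at z)"
proof -
  have 1: "(u has_field_derivative deriv u z) (at z)"
    using assms(2) by (rule analytic_derivI)
  have 2: "(deriv u has_field_derivative deriv (deriv u) z) (at z)"
    using assms(2) by (intro analytic_derivI analytic_deriv)
  have "((\<lambda>z. 2 * u z ^ 2 + 2 * deriv u z + z) has_field_derivative
          2 * (2 * u z * deriv u z) + 2 * deriv (deriv u) z + 1) (at z)"
    by (rule derivative_eq_intros 1 2 refl | simp)+
  also have "2 * (2 * u z * deriv u z) + 2 * deriv (deriv u) z + 1 =
     2 * u z * riccati_defect u z - of_real (2 * \<alpha> - 1)"
    unfolding riccati_defect_def PII_solution_eq[OF assms]
    by (simp add: algebra_simps power2_eq_square power3_eq_cube)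
  finally show ?thesis
    by (simp only: riccati_defect_def[abs_def])
qed

text \<open>This symmetry exchanges the denominators \<open>2 u^2 - 2 u' + z\<close> and \<open>2 u^2 + 2 u' + z\<close> of the
  forward and the inverse Backlund transformation, so only the second one has to be analysed.\<close>

lemma PII_solution_uminus:
  assumes "PII_solution \<alpha> u"
  shows "PII_solution (- \<alpha>) (\<lambda>z. - u z)"
  unfolding PII_solution_def
proof safe
  show "(\<lambda>z. - u z) nicely_meromorphic_on UNIV"
    using assms by (auto simp: PII_solution_def)
next
  fix z assume "\<not> is_pole (\<lambda>z. - u z) z"
  then have an: "u analytic_on {z}"
    using assms PII_solution_analytic_at by simp
  have an': "deriv u analytic_on {z}"
    using an by (rule analytic_deriv)
  have d: "\<forall>\<^sub>F y in nhds z. deriv (\<lambda>z. - u z) y = - deriv u y"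
    using eventually_nhds_analytic[OF an]
    by eventually_elim (simp add: deriv_minus analytic_on_imp_differentiable_at)
  have "deriv (deriv (\<lambda>z. - u z)) z = deriv (\<lambda>y. - deriv u y) z"
    by (rule deriv_cong_ev[OF d refl])
  also have "\<dots> = - deriv (deriv u) z"
    using an' by (simp add: deriv_minus analytic_on_imp_differentiable_at)
  finally show "deriv (deriv (\<lambda>z. - u z)) z = 2 * (- u z) ^ 3 + z * - u z - of_real (- \<alpha>)"
    using PII_solution_eq[OF assms an] by simp
qed

lemma riccati_defect_uminus:
  assumes "u analytic_on {z}"
  shows "riccati_defect (\<lambda>z. - u z) z = 2 * u z ^ 2 - 2 * deriv u z + z"
  using assms by (simp add: riccati_defect_def deriv_minus analytic_on_imp_differentiable_at)

section \<open>The Riccati defect at poles\<close>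


text \<open>If \<open>m\<close> is the order of the pole, then multiplying the equation by \<open>(z - p)^(3 m)\<close> and letting
  \<open>z \<rightarrow> p\<close> leaves only \<open>2 u^3\<close> when \<open>m > 1\<close>, which is impossible, and the condition \<open>2 h = 2 h^3\<close> on the
  leading coefficient when \<open>m = 1\<close>.\<close>

lemma PII_pole_factorization:
  assumes "PII_solution \<alpha> u" "is_pole u p"
  obtains h where "h analytic_on {p}" "h p = 1 \<or> h p = -1"
    "\<forall>\<^sub>F z in at p. u z = h z / (z - p)" "residue u p = h p"
proof -
  have mer: "u meromorphic_on {p}"
    using assms by (auto simp: PII_solution_def nicely_meromorphic_on_def intro: meromorphic_on_subset)
  then obtain h m where h: "h analytic_on {p}" "h p \<noteq> 0" "m \<ge> 1"
    "\<forall>\<^sub>F z in at p. u z = h z / (z - p) ^ m"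
    using pole_factorization assms(2) by blast
  define h1 where "h1 z = (z - p) * deriv h z - of_nat m * h z" for z
  define h2 where "h2 z = (z - p) * deriv h1 z - of_nat (Suc m) * h1 z" for z
  have an1: "h1 analytic_on {p}"
    unfolding h1_def using h(1) by (intro analytic_intros) auto
  have an2: "h2 analytic_on {p}"
    unfolding h2_def using an1 by (intro analytic_intros) auto
  have d1: "\<forall>\<^sub>F z in at p. deriv u z = h1 z / (z - p) ^ Suc m"
    unfolding h1_def by (rule deriv_div_power) (use h in auto)
  have d2: "\<forall>\<^sub>F z in at p. deriv (deriv u) z = h2 z / (z - p) ^ Suc (Suc m)"
    unfolding h2_def by (rule deriv_div_power) (use an1 d1 in auto)
  have "\<forall>\<^sub>F z in at p. z \<noteq> p"
    by (rule eventually_neq_at_within)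
  with d2 h(4) PII_solution_eventually_analytic[OF assms(1), of p]
  have eq: "\<forall>\<^sub>F z in at p. h2 z * (z - p) ^ (2 * m - 2) =
     2 * h z ^ 3 + z * h z * (z - p) ^ (2 * m) - of_real \<alpha> * (z - p) ^ (3 * m)"
  proof eventually_elim
    case (elim z)
    have "h2 z / (z - p) ^ Suc (Suc m) =
          2 * (h z / (z - p) ^ m) ^ 3 + z * (h z / (z - p) ^ m) - of_real \<alpha>"
      using PII_solution_eq[OF assms(1) elim(3)] elim(1,2) by simp
    then have "h2 z / (z - p) ^ Suc (Suc m) * (z - p) ^ (3 * m) =
          (2 * (h z / (z - p) ^ m) ^ 3 + z * (h z / (z - p) ^ m) - of_real \<alpha>) * (z - p) ^ (3 * m)"
      by simp
    also have "\<dots> = 2 * h z ^ 3 + z * h z * (z - p) ^ (2 * m) - of_real \<alpha> * (z - p) ^ (3 * m)"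
    proof -
      have "(z - p) ^ (3 * m) = ((z - p) ^ m) ^ 3" "(z - p) ^ (2 * m) = ((z - p) ^ m) ^ 2"
        by (simp_all add: mult.commute flip: power_mult)
      then show ?thesis
        using elim(4) by (simp add: field_simps power2_eq_square power3_eq_cube)
    qed
    finally have "h2 z / (z - p) ^ Suc (Suc m) * (z - p) ^ (3 * m) =
      2 * h z ^ 3 + z * h z * (z - p) ^ (2 * m) - of_real \<alpha> * (z - p) ^ (3 * m)" .
    moreover have "(z - p) ^ (3 * m) = (z - p) ^ Suc (Suc m) * (z - p) ^ (2 * m - 2)"
    proof -
      have "3 * m = Suc (Suc m) + (2 * m - 2)"
        using h(3) by simp
      then show ?thesis
        by (metis power_add)
    qed
    then have "h2 z / (z - p) ^ Suc (Suc m) * (z - p) ^ (3 * m) = h2 z * (z - p) ^ (2 * m - 2)"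
      using elim(4) by simp
    ultimately show ?case by (simp only:)
  qed
  have lhs: "((\<lambda>z. h2 z * (z - p) ^ (2 * m - 2)) \<longlongrightarrow> h2 p * (p - p) ^ (2 * m - 2)) (at p)"
    by (intro tendsto_intros analytic_tendsto an2)
  have "((\<lambda>z. 2 * h z ^ 3 + z * h z * (z - p) ^ (2 * m) - of_real \<alpha> * (z - p) ^ (3 * m)) \<longlongrightarrow>
        2 * h p ^ 3 + p * h p * (p - p) ^ (2 * m) - of_real \<alpha> * (p - p) ^ (3 * m)) (at p)"
    by (intro tendsto_intros analytic_tendsto h)
  then have rhs: "((\<lambda>z. h2 z * (z - p) ^ (2 * m - 2)) \<longlongrightarrow> 2 * h p ^ 3) (at p)"
    using tendsto_cong[OF eq] h(3) by (simp add: power_0_left)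
  have "h2 p * (p - p) ^ (2 * m - 2) = 2 * h p ^ 3"
    by (rule tendsto_unique[OF _ lhs rhs]) simp
  moreover have "h2 p = of_nat m * of_nat (Suc m) * h p"
    by (simp add: h2_def h1_def)
  ultimately have eq': "of_nat m * of_nat (Suc m) * h p * 0 ^ (2 * m - 2) = 2 * h p ^ 3"
    by simp
  have m: "m = 1"
  proof (rule ccontr)
    assume "m \<noteq> 1"
    then have "2 * m - 2 \<noteq> 0" using h(3) by simp
    then show False using eq' h(2) by (simp add: power_0_left)
  qed
  have "h p = h p ^ 3"
    using eq' m by simp
  then have "h p ^ 2 = 1"
    using h(2) by (simp add: power3_eq_cube power2_eq_square)
  then have hp: "h p = 1 \<or> h p = -1"
    by (simp add: power2_eq_1_iff)
  have u: "\<forall>\<^sub>F z in at p. u z = h z / (z - p)"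
    using h(4) m by simp
  have "residue u p = h p"
  proof -
    obtain S where S: "open S" "p \<in> S" "h holomorphic_on S"
      using h(1) analytic_at by blast
    have "residue u p = residue (\<lambda>z. h z / (z - p)) p"
      by (rule residue_cong) (use u in auto)
    also have "\<dots> = h p"
      by (rule residue_simple) (use S in auto)
    finally show ?thesis .
  qed
  with h(1) hp u show ?thesis using that by blast
qed

text \<open>Turns a limit computation at a point into the decision whether that point is a pole, and of which
  residue.\<close>

lemma PII_tendsto_residue:
  assumes "PII_solution \<alpha> u" "((\<lambda>z. (z - p) * u z) \<longlongrightarrow> L) (at p)"
  shows "(L = 0 \<and> \<not> is_pole u p) \<or> (is_pole u p \<and> residue u p = L \<and> (L = 1 \<or> L = -1))"
proof (cases "is_pole u p")
  case True
  obtain h where h: "h analytic_on {p}" "h p = 1 \<or> h p = -1"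
    "\<forall>\<^sub>F z in at p. u z = h z / (z - p)" "residue u p = h p"
    using PII_pole_factorization[OF assms(1) True] .
  have "\<forall>\<^sub>F z in at p. z \<noteq> p" by (rule eventually_neq_at_within)
  with h(3) have "\<forall>\<^sub>F z in at p. (z - p) * u z = h z"
    by eventually_elim simp
  then have "((\<lambda>z. (z - p) * u z) \<longlongrightarrow> h p) (at p)"
    using analytic_tendsto[OF h(1)] by (simp add: tendsto_cong)
  then have "L = h p"
    using assms(2) tendsto_unique by (metis at_neq_bot)
  then show ?thesis using True h by auto
next
  case False
  have "((\<lambda>z. (z - p) * u z) \<longlongrightarrow> (p - p) * u p) (at p)"
    by (intro tendsto_intros analytic_tendsto PII_solution_analytic_at[OF assms(1) False])
  then have "L = 0"
    using assms(2) tendsto_unique by (metis at_neq_bot diff_self mult_zero_left)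
  then show ?thesis using False by auto
qed

lemma PII_residue:
  assumes "PII_solution \<alpha> u" "is_pole u p"
  shows "residue u p = 1 \<or> residue u p = -1"
proof -
  obtain h where "h p = 1 \<or> h p = -1" "residue u p = h p"
    using PII_pole_factorization[OF assms] .
  then show ?thesis by simp
qed

lemma riccati_defect_near_pole:
  assumes "h analytic_on {p}" "\<forall>\<^sub>F z in at p. u z = h z / (z - p)"
  shows "\<forall>\<^sub>F z in at p. riccati_defect u z =
           (2 * h z ^ 2 + 2 * ((z - p) * deriv h z - h z) + z * (z - p) ^ 2) / (z - p) ^ 2"
proof -
  have "\<forall>\<^sub>F z in at p. deriv u z = ((z - p) * deriv h z - of_nat 1 * h z) / (z - p) ^ Suc 1"
    by (rule deriv_div_power) (use assms in auto)
  with assms(2) eventually_neq_at_within[of p p] show ?thesis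
  proof eventually_elim
    case (elim z)
    have "2 * (a / t) ^ 2 + 2 * ((t * b - of_nat 1 * a) / t ^ Suc 1) + z =
        (2 * a ^ 2 + 2 * (t * b - a) + z * t ^ 2) / t ^ 2" if "t \<noteq> 0" for a b t :: complex
      using that by (simp add: field_simps power2_eq_square)
    then show ?case
      using elim by (simp add: riccati_defect_def)
  qed
qed

text \<open>Here \<open>2 u^2\<close> and \<open>2 u'\<close> both contribute \<open>2 / t^2\<close>, whereas at residue \<open>1\<close> these terms cancel.\<close>

lemma riccati_defect_at_residue_minus_one:
  assumes "PII_solution \<alpha> u" "is_pole u p" "residue u p = -1"
  shows "((\<lambda>z. (z - p) ^ 2 * riccati_defect u z) \<longlongrightarrow> 4) (at p)"
proof -
  obtain h where h: "h analytic_on {p}" "\<forall>\<^sub>F z in at p. u z = h z / (z - p)" "h p = -1"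
    using PII_pole_factorization[OF assms(1,2)] assms(3) by metis
  have an': "deriv h analytic_on {p}" using h(1) by (rule analytic_deriv)
  have "\<forall>\<^sub>F z in at p. (z - p) ^ 2 * riccati_defect u z =
      2 * h z ^ 2 + 2 * ((z - p) * deriv h z - h z) + z * (z - p) ^ 2"
    using riccati_defect_near_pole[OF h(1,2)] eventually_neq_at_within[of p p]
    by eventually_elim simp
  moreover have "((\<lambda>z. 2 * h z ^ 2 + 2 * ((z - p) * deriv h z - h z) + z * (z - p) ^ 2) \<longlongrightarrow>
      2 * h p ^ 2 + 2 * ((p - p) * deriv h p - h p) + p * (p - p) ^ 2) (at p)"
    by (intro tendsto_intros analytic_tendsto h(1) an')
  ultimately show ?thesis
    using h(3) by (simp add: tendsto_cong)
qed

text \<open>With \<open>u = h / t\<close> and \<open>R = k / t^2\<close> the linear equation for \<open>R\<close> becomes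
  \<open>t k' = (2 + 2 h) k - (2 \<alpha> - 1) t^3\<close>. Since \<open>2 + 2 h = 4\<close> at the pole, \<open>k\<close> vanishes to third order there,
  and the third order terms of the equation identify its leading coefficient.\<close>

lemma riccati_defect_at_residue_one:
  assumes "PII_solution \<alpha> u" "is_pole u p" "residue u p = 1"
  shows "((\<lambda>z. riccati_defect u z / (z - p)) \<longlongrightarrow> of_real (2 * \<alpha> - 1)) (at p)"
proof -
  obtain h where h: "h analytic_on {p}" "\<forall>\<^sub>F z in at p. u z = h z / (z - p)" "h p = 1"
    using PII_pole_factorization[OF assms(1,2)] assms(3) by metis
  define c :: complex where "c = of_real (2 * \<alpha> - 1)"
  \<comment> \<open>\<open>g p = 4\<close> differs from \<open>0\<close>, \<open>1\<close> and \<open>2\<close>, so \<open>k\<close> can be divided by \<open>z - p\<close> three times\<close>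
  define g where "g z = 2 + 2 * h z" for z
  define k where "k z = 2 * h z ^ 2 + 2 * ((z - p) * deriv h z - h z) + z * (z - p) ^ 2" for z
  have g: "g analytic_on {p}" unfolding g_def using h(1) by (intro analytic_intros) auto
  have k: "k analytic_on {p}" unfolding k_def using h(1) by (intro analytic_intros) auto
  have R: "\<forall>\<^sub>F z in at p. riccati_defect u z = k z / (z - p) ^ 2"
    unfolding k_def by (rule riccati_defect_near_pole) (use h in auto)
  have gp: "g p = 4" using h(3) by (simp add: g_def)
  have "\<forall>\<^sub>F z in at p. of_nat 0 * k z + (z - p) * deriv k z = g z * k z - c * (z - p) ^ Suc 2"
    using deriv_div_power[OF k R] R h(2) eventually_neq_at_within[of p p] PII_solution_eventually_analytic[OF assms(1), of p]
  proof eventually_elim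
    case (elim z)
    have "((z - p) * deriv k z - of_nat 2 * k z) / (z - p) ^ Suc 2 =
        2 * (h z / (z - p)) * (k z / (z - p) ^ 2) - c"
      using DERIV_imp_deriv[OF deriv_riccati_defect[OF assms(1) elim(5)]] elim(1-3) by (simp add: c_def)
    moreover have "a = 2 * b * d - c * t ^ Suc 2"
      if "a / t ^ Suc 2 = 2 * (b / t) * (d / t ^ 2) - c" "t \<noteq> 0" for a b d t :: complex
    proof -
      have "a = (2 * (b / t) * (d / t ^ 2) - c) * t ^ Suc 2"
        using that by (metis divide_eq_eq power_not_zero)
      also have "\<dots> = 2 * b * d - c * t ^ Suc 2"
        using that(2) by (simp add: field_simps power2_eq_square power3_eq_cube)
      finally show ?thesis .
    qed
    ultimately have "(z - p) * deriv k z - of_nat 2 * k z = 2 * h z * k z - c * (z - p) ^ Suc 2"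
      using elim(4) by simp
    then show ?case
      by (simp add: g_def algebra_simps)
  qed
  moreover have "g p \<noteq> of_nat 0" "g p \<noteq> of_nat 1" "g p \<noteq> of_nat 2" using gp by auto
  ultimately obtain k1 where k1: "k1 analytic_on {p}" "\<forall>\<^sub>F z in nhds p. k z = (z - p) * k1 z"
    "\<forall>\<^sub>F z in at p. of_nat (Suc 0) * k1 z + (z - p) * deriv k1 z = g z * k1 z - c * (z - p) ^ 2"
    using euler_equation_root[OF k g] by blast
  have "g p \<noteq> of_nat (Suc 0)" using gp by auto
  moreover have "\<forall>\<^sub>F z in at p. of_nat (Suc 0) * k1 z + (z - p) * deriv k1 z = g z * k1 z - c * (z - p) ^ Suc 1"
    using k1(3) by (simp add: power2_eq_square)
  ultimately obtain k2 where k2: "k2 analytic_on {p}" "\<forall>\<^sub>F z in nhds p. k1 z = (z - p) * k2 z"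
    "\<forall>\<^sub>F z in at p. of_nat (Suc (Suc 0)) * k2 z + (z - p) * deriv k2 z = g z * k2 z - c * (z - p) ^ 1"
    using euler_equation_root[OF k1(1) g] by blast
  have "g p \<noteq> of_nat (Suc (Suc 0))" using gp by auto
  moreover have "\<forall>\<^sub>F z in at p. of_nat (Suc (Suc 0)) * k2 z + (z - p) * deriv k2 z = g z * k2 z - c * (z - p) ^ Suc 0"
    using k2(3) by simp
  ultimately obtain k3 where k3: "k3 analytic_on {p}" "\<forall>\<^sub>F z in nhds p. k2 z = (z - p) * k3 z"
    "\<forall>\<^sub>F z in at p. of_nat (Suc (Suc (Suc 0))) * k3 z + (z - p) * deriv k3 z = g z * k3 z - c * (z - p) ^ 0"
    using euler_equation_root[OF k2(1) g] by blast
  have "of_nat (Suc (Suc (Suc 0))) * k3 p + (p - p) * deriv k3 p = g p * k3 p - c * (p - p) ^ 0"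
    by (rule eq_at_if_eventually_eq[OF _ _ k3(3)]) (intro analytic_intros k3 g)+
  then have "k3 p = c" using gp by (simp add: algebra_simps)
  have ev: "\<forall>\<^sub>F z in at p. P z" if "\<forall>\<^sub>F z in nhds p. P z" for P
    using that by (simp add: eventually_at_filter eventually_mono)
  have "\<forall>\<^sub>F z in at p. riccati_defect u z / (z - p) = k3 z"
    using R ev[OF k1(2)] ev[OF k2(2)] ev[OF k3(2)] eventually_neq_at_within[of p p]
    by eventually_elim (simp add: power2_eq_square)
  then show ?thesis
    using analytic_tendsto[OF k3(1)] \<open>k3 p = c\<close> by (simp add: tendsto_cong c_def)
qed

lemma riccati_defect_at_zero:
  assumes "PII_solution \<alpha> u" "\<not> is_pole u p" "riccati_defect u p = 0"
  shows "((\<lambda>z. riccati_defect u z / (z - p)) \<longlongrightarrow> - of_real (2 * \<alpha> - 1)) (at p)"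
  using deriv_riccati_defect[OF assms(1) PII_solution_analytic_at[OF assms(1,2)]] assms(3)
  by (simp add: has_field_derivative_iff)

text \<open>At each kind of point the defect, multiplied by a suitable power of \<open>z - p\<close>, has a nonzero limit.\<close>

lemma riccati_defect_isolated_zeros:
  assumes "PII_solution \<alpha> u" "\<alpha> \<noteq> 1 / 2"
  shows "\<forall>\<^sub>F z in at p. riccati_defect u z \<noteq> 0"
proof -
  have c: "complex_of_real (2 * \<alpha> - 1) \<noteq> 0"
    using assms(2) by (subst of_real_eq_0_iff) auto
  consider "is_pole u p" "residue u p = 1" | "is_pole u p" "residue u p = -1"
    | "\<not> is_pole u p" "riccati_defect u p = 0" | "\<not> is_pole u p" "riccati_defect u p \<noteq> 0"
    using PII_residue[OF assms(1)] by blast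
  then show ?thesis
  proof cases
    case 1
    have "\<forall>\<^sub>F z in at p. riccati_defect u z / (z - p) \<noteq> 0"
      using riccati_defect_at_residue_one[OF assms(1) 1] c by (rule tendsto_imp_eventually_ne)
    then show ?thesis by eventually_elim auto
  next
    case 2
    have "\<forall>\<^sub>F z in at p. (z - p) ^ 2 * riccati_defect u z \<noteq> 0"
      using riccati_defect_at_residue_minus_one[OF assms(1) 2] by (rule tendsto_imp_eventually_ne) simp
    then show ?thesis by eventually_elim auto
  next
    case 3
    have "\<forall>\<^sub>F z in at p. riccati_defect u z / (z - p) \<noteq> 0"
      using riccati_defect_at_zero[OF assms(1) 3] by (rule tendsto_imp_eventually_ne) (use c in auto)
    then show ?thesis by eventually_elim auto
  next
    case 4
    show ?thesis
      using analytic_tendsto[OF riccati_defect_analytic[OF PII_solution_analytic_at[OF assms(1) 4(1)]]] 4(2)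
      by (rule tendsto_imp_eventually_ne)
  qed
qed

section \<open>The inverse Backlund transformation\<close>


text \<open>The relation is required on punctured neighbourhoods only, as it is an identity of meromorphic
  functions whose right-hand side has no pointwise value at the poles of \<open>u\<close> and at the zeros of its
  defect.\<close>

definition backlund_down :: "real \<Rightarrow> (complex \<Rightarrow> complex) \<Rightarrow> (complex \<Rightarrow> complex) \<Rightarrow> bool" where
  "backlund_down \<alpha> u w \<longleftrightarrow>
     (\<forall>p. \<forall>\<^sub>F z in at p. w z = - u z + of_real (2 * \<alpha> - 1) / riccati_defect u z)"

lemma backlund_down_tendsto:
  assumes "backlund_down \<alpha> u w"
    "((\<lambda>z. - ((z - p) * u z) + of_real (2 * \<alpha> - 1) * ((z - p) / riccati_defect u z)) \<longlongrightarrow> L) (at p)"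
  shows "((\<lambda>z. (z - p) * w z) \<longlongrightarrow> L) (at p)"
proof -
  have "\<forall>\<^sub>F z in at p. w z = - u z + of_real (2 * \<alpha> - 1) / riccati_defect u z"
    using assms(1) by (auto simp: backlund_down_def)
  then have "\<forall>\<^sub>F z in at p. (z - p) * w z = - ((z - p) * u z) + of_real (2 * \<alpha> - 1) * ((z - p) / riccati_defect u z)"
  proof eventually_elim
    case (elim z)
    have "t * (- a + b / r) = - (t * a) + b * (t / r)" for a b r t :: complex
      by (simp add: right_diff_distrib)
    then show ?case unfolding elim .
  qed
  then show ?thesis
    using assms(2) by (simp add: tendsto_cong)
qed

lemma PII_tendsto_at_pole:
  assumes "PII_solution \<alpha> u" "is_pole u p"
  shows "((\<lambda>z. (z - p) * u z) \<longlongrightarrow> residue u p) (at p)"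
proof -
  obtain h where h: "h analytic_on {p}"
    "\<forall>\<^sub>F z in at p. u z = h z / (z - p)" "residue u p = h p"
    using PII_pole_factorization[OF assms] .
  have "\<forall>\<^sub>F z in at p. (z - p) * u z = h z"
    using h(2) eventually_neq_at_within[of p p] by eventually_elim simp
  then show ?thesis
    using analytic_tendsto[OF h(1)] h(3) by (simp add: tendsto_cong)
qed

lemma PII_tendsto_at_regular:
  assumes "PII_solution \<alpha> u" "\<not> is_pole u p"
  shows "((\<lambda>z. (z - p) * u z) \<longlongrightarrow> 0) (at p)"
proof -
  have "((\<lambda>z. (z - p) * u z) \<longlongrightarrow> (p - p) * u p) (at p)"
    by (intro tendsto_intros analytic_tendsto PII_solution_analytic_at[OF assms])
  then show ?thesis by simp
qed

context
  fixes \<alpha> \<beta> :: real and u w :: "complex \<Rightarrow> complex"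
  assumes u: "PII_solution \<alpha> u" and w: "PII_solution \<beta> w"
    and uw: "backlund_down \<alpha> u w" and \<alpha>: "\<alpha> \<noteq> 1 / 2"
begin

lemma backlund_down_at_residue_minus_one:
  assumes "is_pole u p" "residue u p = -1"
  shows "is_pole w p \<and> residue w p = 1"
proof -
  have "((\<lambda>z. (z - p) ^ 3 / ((z - p) ^ 2 * riccati_defect u z)) \<longlongrightarrow> (p - p) ^ 3 / 4) (at p)"
    by (intro tendsto_intros riccati_defect_at_residue_minus_one[OF u assms]) auto
  moreover have "\<forall>\<^sub>F z in at p. (z - p) ^ 3 / ((z - p) ^ 2 * riccati_defect u z) = (z - p) / riccati_defect u z"
    using eventually_neq_at_within[of p p] by eventually_elim (simp add: power2_eq_square power3_eq_cube)
  ultimately have *: "((\<lambda>z. (z - p) / riccati_defect u z) \<longlongrightarrow> 0) (at p)"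
    by (simp add: tendsto_cong)
  have "((\<lambda>z. - ((z - p) * u z) + of_real (2 * \<alpha> - 1) * ((z - p) / riccati_defect u z)) \<longlongrightarrow>
         - residue u p + of_real (2 * \<alpha> - 1) * 0) (at p)"
    by (intro tendsto_intros * PII_tendsto_at_pole[OF u assms(1)])
  then have "((\<lambda>z. (z - p) * w z) \<longlongrightarrow> 1) (at p)"
    using assms(2) by (intro backlund_down_tendsto[OF uw]) simp
  then show ?thesis using PII_tendsto_residue[OF w] by force
qed

lemma tendsto_quotient_riccati_defect:
  assumes "((\<lambda>z. riccati_defect u z / (z - p)) \<longlongrightarrow> L) (at p)" "L \<noteq> 0"
  shows "((\<lambda>z. (z - p) / riccati_defect u z) \<longlongrightarrow> 1 / L) (at p)"
  using tendsto_divide[OF tendsto_const[of 1] assms] by simp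

lemma backlund_down_at_residue_one:
  assumes "is_pole u p" "residue u p = 1"
  shows "\<not> is_pole w p"
proof -
  have c: "complex_of_real (2 * \<alpha> - 1) \<noteq> 0"
    using \<alpha> by (subst of_real_eq_0_iff) auto
  have "((\<lambda>z. - ((z - p) * u z) + of_real (2 * \<alpha> - 1) * ((z - p) / riccati_defect u z)) \<longlongrightarrow>
         - residue u p + of_real (2 * \<alpha> - 1) * (1 / of_real (2 * \<alpha> - 1))) (at p)"
    by (intro tendsto_intros tendsto_quotient_riccati_defect riccati_defect_at_residue_one[OF u assms] c
          PII_tendsto_at_pole[OF u assms(1)])
  then have "((\<lambda>z. (z - p) * w z) \<longlongrightarrow> 0) (at p)"
    using assms(2) c by (intro backlund_down_tendsto[OF uw]) simp
  then show ?thesis using PII_tendsto_residue[OF w] by force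
qed

lemma backlund_down_at_zero:
  assumes "\<not> is_pole u p" "riccati_defect u p = 0"
  shows "is_pole w p \<and> residue w p = -1"
proof -
  have c: "complex_of_real (2 * \<alpha> - 1) \<noteq> 0"
    using \<alpha> by (subst of_real_eq_0_iff) auto
  then have c': "- complex_of_real (2 * \<alpha> - 1) \<noteq> 0" by simp
  have "((\<lambda>z. - ((z - p) * u z) + of_real (2 * \<alpha> - 1) * ((z - p) / riccati_defect u z)) \<longlongrightarrow>
         - 0 + of_real (2 * \<alpha> - 1) * (1 / - of_real (2 * \<alpha> - 1))) (at p)"
    by (intro tendsto_intros tendsto_quotient_riccati_defect riccati_defect_at_zero[OF u assms] c'
          PII_tendsto_at_regular[OF u assms(1)])
  moreover have "c * (1 / - c) = -1" if "c \<noteq> 0" for c :: complex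
    using that by simp
  note this[OF c]
  ultimately have "((\<lambda>z. (z - p) * w z) \<longlongrightarrow> -1) (at p)"
    by (intro backlund_down_tendsto[OF uw]) (simp only: minus_zero add_0_left)
  then show ?thesis using PII_tendsto_residue[OF w] by force
qed

lemma backlund_down_at_regular:
  assumes "\<not> is_pole u p" "riccati_defect u p \<noteq> 0"
  shows "\<not> is_pole w p"
proof -
  have "((\<lambda>z. - ((z - p) * u z) + of_real (2 * \<alpha> - 1) * ((z - p) / riccati_defect u z)) \<longlongrightarrow>
         - 0 + of_real (2 * \<alpha> - 1) * ((p - p) / riccati_defect u p)) (at p)"
    by (intro tendsto_intros assms(2) PII_tendsto_at_regular[OF u assms(1)]
         analytic_tendsto riccati_defect_analytic PII_solution_analytic_at[OF u assms(1)])
  then have "((\<lambda>z. (z - p) * w z) \<longlongrightarrow> 0) (at p)"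
    by (intro backlund_down_tendsto[OF uw]) simp
  then show ?thesis using PII_tendsto_residue[OF w] by force
qed

lemma backlund_down_residue_one_iff:
  "is_pole w p \<and> residue w p = 1 \<longleftrightarrow> is_pole u p \<and> residue u p = -1"
proof -
  have "(1::complex) \<noteq> - 1" by simp
  then show ?thesis
  using backlund_down_at_residue_minus_one backlund_down_at_residue_one backlund_down_at_zero
    backlund_down_at_regular PII_residue[OF u] by metis
qed

lemma backlund_down_residue_minus_one_iff:
  "is_pole w p \<and> residue w p = -1 \<longleftrightarrow> \<not> is_pole u p \<and> riccati_defect u p = 0"
proof -
  have "(1::complex) \<noteq> - 1" by simp
  then show ?thesis
  using backlund_down_at_residue_minus_one backlund_down_at_residue_one backlund_down_at_zero
    backlund_down_at_regular PII_residue[OF u] by metis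
qed

end

section \<open>Existence of the inverse transform and inversion of the forward transformation\<close>


text \<open>The second equation is the heart of the matter: the defect of \<open>u\<close> is also the forward denominator
  \<open>2 w^2 - 2 w' + z\<close> of \<open>w\<close>. It expresses \<open>w'\<close> through \<open>w\<close> and \<open>R\<close>; differentiating it and using the linear
  equation for \<open>R\<close> gives Painleve II with the lowered parameter.\<close>

lemma backlund_down_local:
  assumes u: "PII_solution \<alpha> u" "u analytic_on {z}" and R: "riccati_defect u z \<noteq> 0"
    and w: "\<forall>\<^sub>F y in nhds z. w y = - u y + of_real (2 * \<alpha> - 1) / riccati_defect u y"
  shows "w analytic_on {z}"
    and "2 * w z ^ 2 - 2 * deriv w z + z = riccati_defect u z"
    and "deriv (deriv w) z = 2 * w z ^ 3 + z * w z - of_real (\<alpha> - 1)"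
proof -
  define c :: complex where "c = of_real (2 * \<alpha> - 1)"
  define W where "W y = - u y + c / riccati_defect u y" for y
  have anR: "riccati_defect u analytic_on {z}"
    using u(2) by (rule riccati_defect_analytic)
  have "W analytic_on {z}"
    unfolding W_def using u(2) anR R by (intro analytic_intros) auto
  moreover have wW: "\<forall>\<^sub>F y in nhds z. w y = W y"
    using w by (simp add: W_def c_def)
  ultimately show an: "w analytic_on {z}"
    using analytic_at_cong[OF wW refl] by simp
  have "\<forall>\<^sub>F y in nhds z. riccati_defect u y \<noteq> 0"
    using tendsto_imp_eventually_ne[OF analytic_tendsto[OF anR] R] R
    by (auto simp: eventually_at_filter elim: eventually_mono)
  moreover have "\<forall>\<^sub>F y in nhds z. \<forall>\<^sub>F x in nhds y. w x = W x"
    using wW by (simp add: eventually_eventually)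
  ultimately have Q: "\<forall>\<^sub>F y in nhds z. deriv w y = w y ^ 2 + y / 2 - riccati_defect u y / 2"
    using eventually_nhds_analytic[OF u(2)]
  proof eventually_elim
    case (elim y)
    have wy: "w y = - u y + c / riccati_defect u y"
      using eventually_nhds_x_imp_x[OF elim(2)] by (simp add: W_def)
    have "deriv w y = deriv W y"
      by (rule deriv_cong_ev) (use elim in auto)
    also have "(W has_field_derivative
        - deriv u y + (0 * riccati_defect u y - c * (2 * u y * riccati_defect u y - c)) /
          (riccati_defect u y * riccati_defect u y)) (at y)"
      unfolding W_def using elim
      by (intro derivative_intros analytic_derivI deriv_riccati_defect[OF u(1), folded c_def]) auto
    then have "deriv W y = - deriv u y + (0 * riccati_defect u y - c * (2 * u y * riccati_defect u y - c)) /
          (riccati_defect u y * riccati_defect u y)"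
      by (rule DERIV_imp_deriv)
    also have "\<dots> = w y ^ 2 + y / 2 - riccati_defect u y / 2"
    proof -
      have *: "deriv u y = (riccati_defect u y - y) / 2 - u y ^ 2"
        by (simp add: riccati_defect_def field_simps)
      show ?thesis
        unfolding wy * using elim(1) by (simp add: field_simps power2_eq_square)
    qed
    finally show ?case .
  qed
  from eventually_nhds_x_imp_x[OF this]
  show "2 * w z ^ 2 - 2 * deriv w z + z = riccati_defect u z"
    by simp
  have "deriv (deriv w) z = deriv (\<lambda>y. w y ^ 2 + y / 2 - riccati_defect u y / 2) z"
    by (rule deriv_cong_ev) (use Q in auto)
  also have "\<dots> = 2 * w z * deriv w z + 1 / 2 - (2 * u z * riccati_defect u z - c) / 2"
    by (rule DERIV_imp_deriv)
      (rule derivative_eq_intros refl analytic_derivI an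
         deriv_riccati_defect[OF u, folded c_def] | simp)+
  also have "\<dots> = 2 * w z ^ 3 + z * w z - of_real (\<alpha> - 1)"
  proof -
    have dw: "deriv w z = w z ^ 2 + z / 2 - riccati_defect u z / 2"
      using eventually_nhds_x_imp_x[OF Q] .
    have "w z = - u z + c / riccati_defect u z"
      using eventually_nhds_x_imp_x[OF wW] by (simp add: W_def)
    then have c: "c = (w z + u z) * riccati_defect u z"
      using R by simp
    have \<alpha>: "of_real (\<alpha> - 1) = c / 2 - 1 / 2"
      by (simp add: c_def field_simps)
    show ?thesis
      unfolding dw \<alpha> c by (simp add: field_simps power2_eq_square power3_eq_cube)
  qed
  finally show "deriv (deriv w) z = 2 * w z ^ 3 + z * w z - of_real (\<alpha> - 1)" .
qed

lemma backlund_down_eventually_local: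
  assumes "PII_solution \<alpha> u" "backlund_down \<alpha> u w" "\<alpha> \<noteq> 1 / 2"
  shows "\<forall>\<^sub>F z in at p. u analytic_on {z} \<and> riccati_defect u z \<noteq> 0 \<and>
    (\<forall>\<^sub>F y in nhds z. w y = - u y + of_real (2 * \<alpha> - 1) / riccati_defect u y)"
  using PII_solution_eventually_analytic[OF assms(1), of p] riccati_defect_isolated_zeros[OF assms(1,3), of p]
    eventually_at_eventually_nhds[OF assms(2)[unfolded backlund_down_def, rule_format, of p]]
  by eventually_elim auto

lemma backlund_down_riccati_defect:
  assumes "PII_solution \<alpha> u" "backlund_down \<alpha> u w" "\<alpha> \<noteq> 1 / 2"
    and "u analytic_on {p}" "w analytic_on {p}"
  shows "2 * w p ^ 2 - 2 * deriv w p + p = riccati_defect u p"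
proof (rule eq_at_if_eventually_eq[where f = "\<lambda>z. 2 * w z ^ 2 - 2 * deriv w z + z"])
  show "(\<lambda>z. 2 * w z ^ 2 - 2 * deriv w z + z) analytic_on {p}"
    using assms(5) by (intro analytic_intros) auto
  show "riccati_defect u analytic_on {p}"
    using assms(4) by (rule riccati_defect_analytic)
  show "\<forall>\<^sub>F z in at p. 2 * w z ^ 2 - 2 * deriv w z + z = riccati_defect u z"
    using backlund_down_eventually_local[OF assms(1-3), of p]
    by eventually_elim (use backlund_down_local(2)[OF assms(1)] in blast)
qed

lemma real_PII_solution_deriv_real:
  assumes "real_PII_solution \<alpha> u" "\<not> is_pole u (of_real x)"
  shows "deriv u (of_real x) \<in> \<real>"
proof (rule deriv_in_Reals)
  show an: "u analytic_on {of_real x}"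
    using assms PII_solution_analytic_at by (auto simp: real_PII_solution_def)
  have "\<forall>\<^sub>F y in nhds x. u analytic_on {of_real y}"
    using eventually_nhds_analytic[OF an] tendsto_of_real[OF filterlim_ident]
    by (rule eventually_compose_filterlim)
  then show "\<forall>\<^sub>F y in nhds x. u (of_real y) \<in> \<real>"
    by eventually_elim (use assms analytic_at_imp_no_pole in \<open>auto simp: real_PII_solution_def\<close>)
qed

text \<open>The candidate is the formula with its removable singularities removed. The differential equation
  holds at generic points and extends to every regular point by continuity; so does being real.\<close>

lemma real_PII_solution_backlund_down:
  assumes "real_PII_solution \<alpha> u" "\<alpha> \<noteq> 1 / 2"
  obtains w where "real_PII_solution (\<alpha> - 1) w" "backlund_down \<alpha> u w"
proof -
  define w0 where "w0 z = - u z + of_real (2 * \<alpha> - 1) / riccati_defect u z" for z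
  define w where "w = remove_sings w0"
  have u: "PII_solution \<alpha> u"
    using assms(1) by (simp add: real_PII_solution_def)
  then have mu: "u meromorphic_on UNIV"
    by (simp add: PII_solution_def nicely_meromorphic_on_def)
  have mw0: "w0 meromorphic_on UNIV"
    unfolding w0_def riccati_defect_def using mu by (intro meromorphic_intros) auto
  have down: "backlund_down \<alpha> u w"
    unfolding backlund_down_def
  proof
    fix p
    have "isolated_singularity_at w0 p"
      using mw0 meromorphic_on_isolated_singularity meromorphic_on_subset by blast
    then show "\<forall>\<^sub>F z in at p. w z = - u z + of_real (2 * \<alpha> - 1) / riccati_defect u z"
      using eventually_remove_sings_eq_at unfolding w_def w0_def by blast
  qed
  have nw: "w nicely_meromorphic_on UNIV"
    unfolding w_def using mw0 by (rule remove_sings_nicely_meromorphic)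
  have PII: "PII_solution (\<alpha> - 1) w"
    unfolding PII_solution_def
  proof safe
    fix p assume "\<not> is_pole w p"
    then have an: "w analytic_on {p}"
      using nw nicely_meromorphic_on_imp_analytic_at by blast
    show "deriv (deriv w) p = 2 * w p ^ 3 + p * w p - of_real (\<alpha> - 1)"
    proof (rule eq_at_if_eventually_eq[where g = "\<lambda>z. 2 * w z ^ 3 + z * w z - of_real (\<alpha> - 1)"])
      show "deriv (deriv w) analytic_on {p}"
        using an by (intro analytic_intros)
      show "(\<lambda>z. 2 * w z ^ 3 + z * w z - of_real (\<alpha> - 1)) analytic_on {p}"
        using an by (intro analytic_intros) auto
      show "\<forall>\<^sub>F z in at p. deriv (deriv w) z = 2 * w z ^ 3 + z * w z - of_real (\<alpha> - 1)"
        using backlund_down_eventually_local[OF u down assms(2), of p]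
        by eventually_elim (use backlund_down_local(3)[OF u] in blast)
    qed
  qed (rule nw)
  have "w (of_real x) \<in> \<real>" if "\<not> is_pole w (of_real x)" for x
  proof -
    have "w analytic_on {of_real x}"
      using PII that by (rule PII_solution_analytic_at)
    then have lim: "((\<lambda>y. w (of_real y)) \<longlongrightarrow> w (of_real x)) (at x)"
      by (rule filterlim_compose[OF analytic_tendsto filterlim_of_real_at])
    have "\<forall>\<^sub>F y in at x. u analytic_on {of_real y}"
      using PII_solution_eventually_analytic[OF u] filterlim_of_real_at by (rule eventually_compose_filterlim)
    moreover have "\<forall>\<^sub>F y in at x. w (of_real y) = - u (of_real y) + of_real (2 * \<alpha> - 1) / riccati_defect u (of_real y)"
      using down[unfolded backlund_down_def, rule_format] filterlim_of_real_at by (rule eventually_compose_filterlim)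
    ultimately have "\<forall>\<^sub>F y in at x. w (of_real y) \<in> \<real>"
    proof eventually_elim
      case (elim y)
      have "\<not> is_pole u (of_real y)"
        using elim analytic_at_imp_no_pole by blast
      then have "u (of_real y) \<in> \<real>" "deriv u (of_real y) \<in> \<real>"
        using assms(1) real_PII_solution_deriv_real by (auto simp: real_PII_solution_def)
      then show ?case
        unfolding elim(2) riccati_defect_def
        by (intro Reals_add Reals_minus Reals_divide Reals_mult Reals_power Reals_of_real) auto
    qed
    from Lim_in_closed_set[OF closed_complex_Reals this _ lim] show ?thesis
      by simp
  qed
  with PII down show ?thesis
    using that by (auto simp: real_PII_solution_def)
qed

text \<open>By the symmetry \<open>u \<mapsto> - u\<close> a forward step from \<open>u\<close> to \<open>v\<close> is an inverse step from \<open>- u\<close> to \<open>- v\<close>.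
  The identity of denominators then says that the defect of \<open>v\<close> is the denominator of the forward step, so
  solving the relation for \<open>u\<close> yields the inverse step from \<open>v\<close> to \<open>u\<close>.\<close>

lemma Backlund_related_imp_backlund_down:
  assumes u: "PII_solution \<alpha> u" and v: "PII_solution (\<alpha> + 1) v"
    and rel: "Backlund_related \<alpha> u v" and "\<alpha> \<noteq> - 1 / 2"
  shows "backlund_down (\<alpha> + 1) v u"
  unfolding backlund_down_def
proof
  fix p
  define u' where "u' z = - u z" for z
  have u': "PII_solution (- \<alpha>) u'"
    unfolding u'_def using u by (rule PII_solution_uminus)
  have ne: "- \<alpha> \<noteq> 1 / 2" using assms(4) by auto
  have "backlund_down (- \<alpha>) u' (\<lambda>z. - v z)"
    unfolding backlund_down_def
  proof
    fix p
    show "\<forall>\<^sub>F z in at p. - v z = - u' z + of_real (2 * - \<alpha> - 1) / riccati_defect u' z"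
      using PII_solution_eventually_analytic[OF u, of p] riccati_defect_isolated_zeros[OF u' ne, of p]
    proof eventually_elim
      case (elim z)
      have R: "riccati_defect u' z = 2 * u z ^ 2 - 2 * deriv u z + z"
        unfolding u'_def using elim(1) by (rule riccati_defect_uminus)
      have "v z = - u z + of_real (2 * \<alpha> + 1) / riccati_defect u' z"
        using rel elim analytic_at_imp_no_pole unfolding Backlund_related_def R by blast
      moreover have "complex_of_real (2 * - \<alpha> - 1) = - of_real (2 * \<alpha> + 1)"
        by simp
      ultimately show ?case
        by (simp only: u'_def minus_add_distrib minus_minus minus_divide_left)
    qed
  qed
  from backlund_down_eventually_local[OF u' this ne, of p]
  show "\<forall>\<^sub>F z in at p. u z = - v z + of_real (2 * (\<alpha> + 1) - 1) / riccati_defect v z"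
  proof eventually_elim
    case (elim z)
    then have an: "(\<lambda>z. - v z) analytic_on {z}"
      and R: "2 * (- v z) ^ 2 - 2 * deriv (\<lambda>z. - v z) z + z = riccati_defect u' z"
      using backlund_down_local[OF u', of z "\<lambda>z. - v z"] by auto
    from an have anv: "v analytic_on {z}"
      using analytic_on_neg[OF an] by simp
    have R': "riccati_defect v z = riccati_defect u' z"
      using R anv by (simp add: riccati_defect_def deriv_minus analytic_on_imp_differentiable_at)
    have vz: "- v z = - u' z + of_real (2 * - \<alpha> - 1) / riccati_defect u' z"
      using elim eventually_nhds_x_imp_x by blast
    have "complex_of_real (2 * (\<alpha> + 1) - 1) = - of_real (2 * - \<alpha> - 1)"
      by simp
    then show ?case
      unfolding R' vz by (simp only: u'_def minus_divide_left [symmetric]) simp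
  qed
qed

section \<open>Two comparison principles for real functions\<close>


text \<open>The product of \<open>f\<close> with the integrating factor \<open>exp (- G)\<close>, \<open>G\<close> an antiderivative of \<open>g\<close>, is strictly
  increasing.\<close>

lemma linear_comparison:
  fixes f f' g :: "real \<Rightarrow> real"
  assumes "a < b" "f a \<ge> 0" and g: "continuous_on {a..b} g"
    and f: "\<And>t. t \<in> {a..b} \<Longrightarrow> (f has_real_derivative f' t) (at t)"
    and ineq: "\<And>t. t \<in> {a..b} \<Longrightarrow> f' t > g t * f t"
  shows "f b > 0"
proof -
  define G where "G t = integral {a..t} g" for t
  have G: "(G has_real_derivative g t) (at t within {a..b})" if "t \<in> {a..b}" for t
    unfolding G_def using g that by (rule integral_has_real_derivative)
  have F: "((\<lambda>t. f t * exp (- G t)) has_real_derivative (f' t - g t * f t) * exp (- G t)) (at t within {a..b})"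
    if "t \<in> {a..b}" for t
  proof -
    have "((\<lambda>t. f t * exp (- G t)) has_real_derivative
        f' t * exp (- G t) + (exp (- G t) * - g t) * f t) (at t within {a..b})"
      using that by (intro DERIV_mult has_field_derivative_at_within[OF f] DERIV_chain2[OF DERIV_exp] DERIV_minus G)
    then show ?thesis by (simp add: algebra_simps)
  qed
  have "f a * exp (- G a) < f b * exp (- G b)"
  proof (rule DERIV_pos_imp_increasing_open[where f = "\<lambda>t. f t * exp (- G t)", OF \<open>a < b\<close>])
    fix t assume "a < t" "t < b"
    then show "\<exists>y. ((\<lambda>t. f t * exp (- G t)) has_real_derivative y) (at t) \<and> y > 0"
      using F[of t] ineq[of t] by (intro exI[of _ "(f' t - g t * f t) * exp (- G t)"]) (simp add: at_within_Icc_at)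
  next
    show "continuous_on {a..b} (\<lambda>t. f t * exp (- G t))"
      by (rule DERIV_continuous_on[OF F])
  qed
  moreover have "f a * exp (- G a) \<ge> 0"
    using assms(2) by simp
  ultimately have "f b * exp (- G b) > 0"
    by linarith
  then show ?thesis
    by (simp add: zero_less_mult_iff)
qed

text \<open>Multiplying \<open>F'' \<ge> F^2\<close> by \<open>2 F'\<close> and integrating bounds \<open>F'^2\<close> below by a multiple of \<open>F^3\<close> once \<open>F\<close> is
  large; then \<open>1 / sqrt F\<close> decreases at least linearly and reaches \<open>0\<close> in finite time. The lower bound \<open>c\<close>
  on \<open>F'\<close> serves to make \<open>F\<close> large.\<close>

lemma quadratic_blowup:
  fixes F G H :: "real \<Rightarrow> real"
  assumes F: "\<And>y. y \<ge> a \<Longrightarrow> (F has_real_derivative G y) (at y)"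
    and G: "\<And>y. y \<ge> a \<Longrightarrow> (G has_real_derivative H y) (at y)"
    and pos: "\<And>y. y \<ge> a \<Longrightarrow> F y > 0" "\<And>y. y \<ge> a \<Longrightarrow> G y \<ge> c" "c > 0"
    and ineq: "\<And>y. y \<ge> a \<Longrightarrow> H y \<ge> F y ^ 2"
  shows False
proof -
  \<comment> \<open>the energy of \<open>F'' = F^2\<close>\<close>
  define E where "E y = G y ^ 2 - 2 / 3 * F y ^ 3" for y
  have dE: "(E has_real_derivative 2 * G y * (H y - F y ^ 2)) (at y)" if "y \<ge> a" for y
    unfolding E_def
    by (rule derivative_eq_intros F G that refl | simp)+ (simp add: algebra_simps)
  have E: "E a \<le> E y" if "y \<ge> a" for y
  proof (rule DERIV_nonneg_imp_nondecreasing[where f = E, OF that])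
    fix x assume "a \<le> x" "x \<le> y"
    then show "\<exists>d. (E has_real_derivative d) (at x) \<and> 0 \<le> d"
      using dE[of x] ineq[of x] pos(2)[of x] pos(3) by (intro exI conjI) auto
  qed
  have lin: "F y \<ge> c * (y - a)" if "y \<ge> a" for y
  proof -
    have "F a - c * a \<le> F y - c * y"
    proof (rule DERIV_nonneg_imp_nondecreasing[where f = "\<lambda>y. F y - c * y", OF that])
      fix x assume "a \<le> x" "x \<le> y"
      then show "\<exists>d. ((\<lambda>y. F y - c * y) has_real_derivative d) (at x) \<and> 0 \<le> d"
        by (intro exI[of _ "G x - c"] conjI) (auto intro!: derivative_eq_intros F pos(2))
    qed
    then show ?thesis using pos(1)[of a] by (simp add: algebra_simps)
  qed
  \<comment> \<open>from \<open>b\<close> on the cubic term of the energy dominates its initial value\<close>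
  define b where "b = a + (1 + 3 * \<bar>E a\<bar>) / c"
  have b: "b \<ge> a" using pos(3) by (simp add: b_def)
  have big: "G y ^ 2 \<ge> F y ^ 3 / 3" if "y \<ge> b" for y
  proof -
    have "1 + 3 * \<bar>E a\<bar> \<le> c * (y - a)"
      using that pos(3) by (simp add: b_def field_simps)
    also have "\<dots> \<le> F y" using lin that b by simp
    finally have F1: "F y \<ge> 1 + 3 * \<bar>E a\<bar>" .
    then have "F y ^ 1 \<le> F y ^ 3" by (intro power_increasing) auto
    then have "F y ^ 3 \<ge> 3 * \<bar>E a\<bar>" using F1 by simp
    then show ?thesis
      using E[of y] that b unfolding E_def[of y] by linarith
  qed
  define K where "K y = 1 / sqrt (F y)" for y
  have dK: "(K has_real_derivative - (G y / (2 * F y * sqrt (F y)))) (at y)" if "y \<ge> b" for y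
  proof -
    have "F y > 0" using that b pos(1) by simp
    then show ?thesis
      unfolding K_def
      by (auto intro!: derivative_eq_intros F simp: that order_trans[OF b that] field_simps)
  qed
  have slope: "G y / (2 * F y * sqrt (F y)) \<ge> 1 / 4" if "y \<ge> b" for y
  proof -
    have Fy: "F y > 0" and Gy: "G y > 0"
      using that b pos(1)[of y] pos(2)[of y] pos(3) by auto
    have "(F y * sqrt (F y)) ^ 2 = F y ^ 3"
      using Fy by (simp add: power_mult_distrib power2_eq_square power3_eq_cube)
    then have "(F y * sqrt (F y) / 2) ^ 2 \<le> G y ^ 2"
      using big[OF that] Fy by (simp add: power_divide) (smt (verit) zero_less_power)
    then have "F y * sqrt (F y) / 2 \<le> G y"
      using Gy by (meson less_imp_le power2_le_imp_le)
    then show ?thesis using Fy by (simp add: field_simps)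
  qed
  have "K (b + 4 * K b) + (b + 4 * K b) / 4 \<le> K b + b / 4"
  proof (rule DERIV_nonpos_imp_nonincreasing[where f = "\<lambda>y. K y + y / 4"])
    show "b \<le> b + 4 * K b" using pos(1)[OF b] by (simp add: K_def)
    fix x assume "b \<le> x"
    then show "\<exists>d. ((\<lambda>y. K y + y / 4) has_real_derivative d) (at x) \<and> d \<le> 0"
      using slope[of x] by (intro exI[of _ "- (G x / (2 * F x * sqrt (F x))) + 1 / 4"] conjI)
        (auto intro!: derivative_eq_intros dK)
  qed
  then have "K (b + 4 * K b) \<le> 0" by argo
  moreover have "b + 4 * K b \<ge> a"
    using b pos(1)[OF b] by (simp add: K_def add_increasing2)
  ultimately show False
    using pos(1)[of "b + 4 * K b"] by (simp add: K_def)
qed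

lemma Icc_disjoint:
  fixes a b :: real
  assumes "a \<notin> S" "b \<notin> S" "\<And>t. a < t \<Longrightarrow> t < b \<Longrightarrow> t \<notin> S"
  shows "{a..b} \<inter> S = {}"
proof -
  have "t \<notin> S" if "a \<le> t" "t \<le> b" for t
    using that assms by (cases "t = a"; cases "t = b") auto
  then show ?thesis by auto
qed

section \<open>Sign changes of the Riccati defect on the real line\<close>


text \<open>On the real line a real solution, its derivative and its defect are real away from the poles of the
  solution, so that taking real parts loses nothing and makes them accessible to real calculus.\<close>

definition on_reals :: "(complex \<Rightarrow> complex) \<Rightarrow> real \<Rightarrow> real" where
  "on_reals f x = Re (f (of_real x))"

definition plus_poles :: "(complex \<Rightarrow> complex) \<Rightarrow> real set" where
  "plus_poles u = {x. is_pole u (of_real x) \<and> residue u (of_real x) = 1}"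

definition minus_poles :: "(complex \<Rightarrow> complex) \<Rightarrow> real set" where
  "minus_poles u = {x. is_pole u (of_real x) \<and> residue u (of_real x) = -1}"

definition riccati_zeros :: "(complex \<Rightarrow> complex) \<Rightarrow> real set" where
  "riccati_zeros u = {x. \<not> is_pole u (of_real x) \<and> riccati_defect u (of_real x) = 0}"

lemma has_derivative_on_reals:
  assumes "(f has_field_derivative D) (at (of_real x))"
  shows "(on_reals f has_real_derivative Re D) (at x)"
  using bounded_linear.has_vector_derivative[OF bounded_linear_Re has_vector_derivative_real_field[OF assms]]
  unfolding on_reals_def[abs_def] by (simp add: has_real_derivative_iff_has_vector_derivative)

lemma real_poles_eq:
  assumes "PII_solution \<alpha> u"
  shows "real_poles u = plus_poles u \<union> minus_poles u"
  using PII_residue[OF assms] by (auto simp: real_poles_def plus_poles_def minus_poles_def)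

lemma plus_minus_poles_disjoint: "plus_poles u \<inter> minus_poles u = {}"
proof -
  have "(1 :: complex) \<noteq> -1" by simp
  then show ?thesis by (auto simp: plus_poles_def minus_poles_def)
qed

lemma eventually_at_pick:
  assumes "\<forall>\<^sub>F y in at (x::real). P y"
  shows "a < x \<Longrightarrow> \<exists>t. a < t \<and> t < x \<and> P t" "x < b \<Longrightarrow> \<exists>t. x < t \<and> t < b \<and> P t"
proof -
  have L: "\<forall>\<^sub>F y in at_left x. P y" and R: "\<forall>\<^sub>F y in at_right x. P y"
    using assms by (auto simp: eventually_at_split)
  show "\<exists>t. a < t \<and> t < x \<and> P t" if "a < x"
    using eventually_happens'[OF _ eventually_conj[OF L eventually_at_left_real[OF that]]]
    by (auto simp: trivial_limit_at_left_real)
  show "\<exists>t. x < t \<and> t < b \<and> P t" if "x < b"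
    using eventually_happens'[OF _ eventually_conj[OF R eventually_at_right_real[OF that]]]
    by (auto simp: trivial_limit_at_right_real)
qed

context
  fixes \<alpha> :: real and u :: "complex \<Rightarrow> complex"
  assumes u: "real_PII_solution \<alpha> u" and fin: "finite (real_poles u)"
begin

lemma PII_solution_of_real: "PII_solution \<alpha> u"
  using u by (simp add: real_PII_solution_def)

lemma real_regular_analytic: "x \<notin> real_poles u \<Longrightarrow> u analytic_on {of_real x}"
  using PII_solution_analytic_at[OF PII_solution_of_real] by (auto simp: real_poles_def)

lemma on_reals_of_real:
  assumes "x \<notin> real_poles u"
  shows "u (of_real x) = of_real (on_reals u x)"
    and "deriv u (of_real x) = of_real (on_reals (deriv u) x)"
    and "riccati_defect u (of_real x) = of_real (on_reals (riccati_defect u) x)"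
proof -
  show 1: "u (of_real x) = of_real (on_reals u x)"
    and 2: "deriv u (of_real x) = of_real (on_reals (deriv u) x)"
    using assms u real_PII_solution_deriv_real[OF u]
    by (auto simp: on_reals_def real_poles_def real_PII_solution_def)
  show "riccati_defect u (of_real x) = of_real (on_reals (riccati_defect u) x)"
    by (simp add: riccati_defect_def on_reals_def[of "riccati_defect u"] 1 2 complex_eq_iff power2_eq_square)
qed

lemma on_reals_defect:
  assumes "x \<notin> real_poles u"
  shows "on_reals (deriv u) x = (on_reals (riccati_defect u) x - x) / 2 - on_reals u x ^ 2"
  by (simp add: field_simps riccati_defect_def on_reals_def[of "riccati_defect u"] on_reals_of_real(1,2)[OF assms] power2_eq_square)

lemma deriv_on_reals:
  assumes "x \<notin> real_poles u"
  shows "(on_reals u has_real_derivative (on_reals (riccati_defect u) x - x) / 2 - on_reals u x ^ 2) (at x)"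
  using has_derivative_on_reals[OF analytic_derivI[OF real_regular_analytic[OF assms]]]
    on_reals_defect[OF assms] by (simp add: on_reals_def)

lemma deriv_on_reals_defect:
  assumes "x \<notin> real_poles u"
  shows "(on_reals (riccati_defect u) has_real_derivative
     2 * on_reals u x * on_reals (riccati_defect u) x - (2 * \<alpha> - 1)) (at x)"
  using has_derivative_on_reals[OF deriv_riccati_defect[OF PII_solution_of_real real_regular_analytic[OF assms]]]
  by (simp add: on_reals_of_real[OF assms])

lemma continuous_on_reals:
  assumes "S \<inter> real_poles u = {}"
  shows "continuous_on S (on_reals u)" "continuous_on S (on_reals (riccati_defect u))"
proof -
  have *: "x \<notin> real_poles u" if "x \<in> S" for x
    using assms that by auto
  show "continuous_on S (on_reals u)"
    by (intro continuous_at_imp_continuous_on ballI DERIV_isCont[OF deriv_on_reals] *)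
  show "continuous_on S (on_reals (riccati_defect u))"
    by (intro continuous_at_imp_continuous_on ballI DERIV_isCont[OF deriv_on_reals_defect] *)
qed

lemma eventually_regular: "\<forall>\<^sub>F y in at x. y \<notin> real_poles u"
proof -
  have "finite (real_poles u - {x})" using fin by simp
  then have "open (- (real_poles u - {x}))" by (intro open_Compl finite_imp_closed)
  then have "\<forall>\<^sub>F y in nhds x. y \<in> - (real_poles u - {x})" by (intro eventually_nhds_in_open) auto
  then show ?thesis by (auto simp: eventually_at_filter elim: eventually_mono)
qed

text \<open>The quotient is real along the real line, so the sign of its limit decides the direction in which
  the defect crosses zero at \<open>x\<close>.\<close>

lemma eventually_sign_from_quotient:
  assumes "((\<lambda>z. riccati_defect u z / (z - of_real x)) \<longlongrightarrow> of_real L) (at (of_real x))" "L \<noteq> 0"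
  shows "\<forall>\<^sub>F y in at x. y \<notin> real_poles u \<and> sgn (on_reals (riccati_defect u) y) = sgn L * sgn (y - x)"
proof -
  have "((\<lambda>y. riccati_defect u (of_real y) / (of_real y - of_real x)) \<longlongrightarrow> of_real L) (at x)"
    using assms(1) filterlim_of_real_at by (rule filterlim_compose)
  then have lim: "((\<lambda>y. Re (riccati_defect u (of_real y) / (of_real y - of_real x))) \<longlongrightarrow> Re (of_real L)) (at x)"
    by (rule tendsto_Re)
  have eq: "\<forall>\<^sub>F y in at x. Re (riccati_defect u (of_real y) / (of_real y - of_real x)) =
      on_reals (riccati_defect u) y / (y - x)"
    using eventually_regular
  proof eventually_elim
    case (elim y)
    show ?case
      unfolding on_reals_of_real(3)[OF elim] of_real_diff[symmetric] of_real_divide[symmetric] by simp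
  qed
  have "((\<lambda>y. on_reals (riccati_defect u) y / (y - x)) \<longlongrightarrow> L) (at x)"
    using Lim_transform_eventually[OF lim eq] by simp
  then have "((\<lambda>y. on_reals (riccati_defect u) y / (y - x) * sgn L) \<longlongrightarrow> L * sgn L) (at x)"
    by (intro tendsto_intros)
  moreover have "L * sgn L > 0" using assms(2) by (auto simp: sgn_real_def)
  ultimately have "\<forall>\<^sub>F y in at x. on_reals (riccati_defect u) y / (y - x) * sgn L > 0"
    by (rule order_tendstoD)
  with eventually_regular show ?thesis
  proof eventually_elim
    case (elim y)
    then show ?case
      by (auto simp: sgn_real_def zero_less_mult_iff zero_less_divide_iff split: if_splits)
  qed
qed

lemma defect_positive_near_minus_pole:
  assumes "d \<in> minus_poles u"
  shows "\<forall>\<^sub>F y in at d. y \<notin> real_poles u \<and> on_reals (riccati_defect u) y > 0"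
proof -
  have "((\<lambda>z. (z - of_real d) ^ 2 * riccati_defect u z) \<longlongrightarrow> 4) (at (of_real d))"
    using assms by (intro riccati_defect_at_residue_minus_one[OF PII_solution_of_real]) (auto simp: minus_poles_def)
  then have "((\<lambda>y. (of_real y - of_real d) ^ 2 * riccati_defect u (of_real y)) \<longlongrightarrow> 4) (at d)"
    using filterlim_of_real_at by (rule filterlim_compose)
  then have "((\<lambda>y. Re ((of_real y - of_real d) ^ 2 * riccati_defect u (of_real y))) \<longlongrightarrow> Re 4) (at d)"
    by (rule tendsto_Re)
  then have "\<forall>\<^sub>F y in at d. Re ((of_real y - of_real d) ^ 2 * riccati_defect u (of_real y)) > 0"
    by (rule order_tendstoD) simp
  with eventually_regular show ?thesis
  proof eventually_elim
    case (elim y)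
    have "Re ((of_real y - of_real d) ^ 2 * riccati_defect u (of_real y)) =
        (y - d) ^ 2 * on_reals (riccati_defect u) y"
      unfolding on_reals_of_real(3)[OF elim(1)] of_real_diff[symmetric] of_real_power[symmetric]
        of_real_mult[symmetric] by simp
    then show ?case
      using elim by (auto simp: zero_less_mult_iff)
  qed
qed

lemma eventually_regular_at_bot: "\<forall>\<^sub>F x in at_bot. x \<notin> real_poles u"
proof (cases "real_poles u = {}")
  case False
  show ?thesis
    using eventually_gt_at_bot[of "Min (real_poles u)"] fin
    by (auto elim!: eventually_mono simp: False)
qed auto

lemma eventually_regular_at_top: "\<forall>\<^sub>F x in at_top. x \<notin> real_poles u"
proof (cases "real_poles u = {}")
  case False
  show ?thesis
    using eventually_gt_at_top[of "Max (real_poles u)"] fin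
    by (auto elim!: eventually_mono simp: False)
qed auto

context
  assumes \<alpha>: "\<alpha> > 1 / 2"
begin

lemma near_plus_pole:
  assumes "p \<in> plus_poles u"
  shows "\<forall>\<^sub>F y in at p. y \<notin> real_poles u \<and> sgn (on_reals (riccati_defect u) y) = sgn (y - p)"
proof -
  have "\<forall>\<^sub>F y in at p. y \<notin> real_poles u \<and>
      sgn (on_reals (riccati_defect u) y) = sgn (2 * \<alpha> - 1) * sgn (y - p)"
    using assms \<alpha> by (intro eventually_sign_from_quotient riccati_defect_at_residue_one[OF PII_solution_of_real])
      (auto simp: plus_poles_def)
  then show ?thesis using \<alpha> by simp
qed

lemma near_riccati_zero:
  assumes "z \<in> riccati_zeros u"
  shows "\<forall>\<^sub>F y in at z. y \<notin> real_poles u \<and> sgn (on_reals (riccati_defect u) y) = - sgn (y - z)"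
proof -
  have "((\<lambda>t. riccati_defect u t / (t - of_real z)) \<longlongrightarrow> of_real (- (2 * \<alpha> - 1))) (at (of_real z))"
    using riccati_defect_at_zero[OF PII_solution_of_real, of "of_real z"] assms by (auto simp: riccati_zeros_def)
  then have "\<forall>\<^sub>F y in at z. y \<notin> real_poles u \<and>
      sgn (on_reals (riccati_defect u) y) = sgn (- (2 * \<alpha> - 1)) * sgn (y - z)"
    using \<alpha> by (intro eventually_sign_from_quotient) auto
  then show ?thesis using \<alpha> by simp
qed

text \<open>The defect solves \<open>R' = 2 u R - (2 \<alpha> - 1)\<close>, whose inhomogeneity pushes downwards.\<close>

lemma defect_stays_negative:
  assumes "x < y" "{x..y} \<inter> real_poles u = {}" "on_reals (riccati_defect u) x \<le> 0"
  shows "on_reals (riccati_defect u) y < 0"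
proof -
  have "- on_reals (riccati_defect u) y > 0"
  proof (rule linear_comparison[OF assms(1)])
    show "continuous_on {x..y} (\<lambda>t. 2 * on_reals u t)"
      using continuous_on_reals(1)[OF assms(2)] by (intro continuous_intros)
    fix t assume "t \<in> {x..y}"
    then have t: "t \<notin> real_poles u" using assms(2) by auto
    show "((\<lambda>t. - on_reals (riccati_defect u) t) has_real_derivative
        - (2 * on_reals u t * on_reals (riccati_defect u) t - (2 * \<alpha> - 1))) (at t)"
      by (rule DERIV_minus[OF deriv_on_reals_defect[OF t]])
    show "- (2 * on_reals u t * on_reals (riccati_defect u) t - (2 * \<alpha> - 1)) >
        2 * on_reals u t * - on_reals (riccati_defect u) t"
      using \<alpha> by simp
  qed (use assms in simp)
  then show ?thesis by simp
qed

text \<open>Without a pole of residue \<open>1\<close> the first pole after \<open>x\<close> would have residue \<open>-1\<close>; up to there the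
  defect would stay negative, although it tends to \<open>+\<infinity>\<close> there.\<close>

lemma plus_pole_between:
  assumes "x < y" "x \<notin> real_poles u" "y \<notin> real_poles u"
    and "on_reals (riccati_defect u) x < 0" "on_reals (riccati_defect u) y > 0"
  shows "\<exists>p \<in> plus_poles u. x < p \<and> p < y"
proof (rule ccontr)
  assume no: "\<not> ?thesis"
  define A where "A = real_poles u \<inter> {x<..<y}"
  have fA: "finite A" using fin by (simp add: A_def)
  show False
  proof (cases "A = {}")
    case True
    then have "{x..y} \<inter> real_poles u = {}"
      using assms(2,3) by (intro Icc_disjoint) (auto simp: A_def)
    then show False using defect_stays_negative[of x y] assms by simp
  next
    case False
    define d where "d = Min A"
    have "d \<in> A" and least: "\<And>a. a \<in> A \<Longrightarrow> d \<le> a"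
      using fA False by (auto simp: d_def)
    then have d: "x < d" "d < y" "d \<in> minus_poles u"
      using no real_poles_eq[OF PII_solution_of_real] by (auto simp: A_def)
    obtain t where t: "x < t" "t < d" "t \<notin> real_poles u" "on_reals (riccati_defect u) t > 0"
      using eventually_at_pick(1)[OF defect_positive_near_minus_pole[OF d(3)] d(1)] by auto
    have "{x..t} \<inter> real_poles u = {}"
    proof (rule Icc_disjoint)
      fix s assume "x < s" "s < t"
      then show "s \<notin> real_poles u"
        using t d least[of s] by (auto simp: A_def)
    qed (use assms(2) t in auto)
    then show False using defect_stays_negative[of x t] assms t by simp
  qed
qed

lemma riccati_zero_between_regular:
  assumes "x < y" "{x..y} \<inter> real_poles u = {}"
    and "on_reals (riccati_defect u) x > 0" "on_reals (riccati_defect u) y < 0"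
  shows "\<exists>z \<in> riccati_zeros u. x < z \<and> z < y"
proof -
  have "\<exists>z. x \<le> z \<and> z \<le> y \<and> on_reals (riccati_defect u) z = 0"
    using assms continuous_on_reals(2)[OF assms(2)] 
      by (intro IVT2'[of "on_reals (riccati_defect u)"]) (auto intro: less_imp_le)
  then obtain z where z: "x \<le> z" "z \<le> y" "on_reals (riccati_defect u) z = 0" by auto
  then have "z \<notin> real_poles u" using assms(2) by auto
  then have "z \<in> riccati_zeros u"
    using z(3) on_reals_of_real(3)[of z] by (simp add: riccati_zeros_def real_poles_def)
  moreover have "x \<noteq> z" "z \<noteq> y" using z assms by auto
  ultimately show ?thesis using z by (intro bexI[of _ z]) auto
qed

text \<open>To the right of every pole, whatever its residue, the defect is positive, so the intermediate value
  theorem applies between the last pole before \<open>y\<close> and \<open>y\<close>.\<close>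

lemma riccati_zero_between:
  assumes "x < y" "x \<notin> real_poles u" "y \<notin> real_poles u"
    and "on_reals (riccati_defect u) x > 0" "on_reals (riccati_defect u) y < 0"
  shows "\<exists>z \<in> riccati_zeros u. x < z \<and> z < y"
proof -
  define A where "A = real_poles u \<inter> {x<..<y}"
  have fA: "finite A" using fin by (simp add: A_def)
  show ?thesis
  proof (cases "A = {}")
    case True
    then have "{x..y} \<inter> real_poles u = {}"
      using assms(2,3) by (intro Icc_disjoint) (auto simp: A_def)
    then show ?thesis using riccati_zero_between_regular assms by blast
  next
    case False
    define q where "q = Max A"
    have "q \<in> A" and greatest: "\<And>a. a \<in> A \<Longrightarrow> a \<le> q"
      using fA False by (auto simp: q_def)
    then have q: "x < q" "q < y" "q \<in> plus_poles u \<or> q \<in> minus_poles u"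
      using real_poles_eq[OF PII_solution_of_real] by (auto simp: A_def)
    obtain t where t: "q < t" "t < y" "t \<notin> real_poles u" "on_reals (riccati_defect u) t > 0"
      using q(3)
    proof
      assume "q \<in> plus_poles u"
      from eventually_at_pick(2)[OF near_plus_pole[OF this] q(2)]
      obtain t where "q < t" "t < y" "t \<notin> real_poles u" "sgn (on_reals (riccati_defect u) t) = sgn (t - q)" by auto
      then show thesis using that by (auto simp: sgn_real_def split: if_splits)
    next
      assume "q \<in> minus_poles u"
      from eventually_at_pick(2)[OF defect_positive_near_minus_pole[OF this] q(2)]
      show thesis using that by auto
    qed
    have "{t..y} \<inter> real_poles u = {}"
    proof (rule Icc_disjoint)
      fix s assume "t < s" "s < y"
      then show "s \<notin> real_poles u"
        using t q greatest[of s] by (auto simp: A_def)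
    qed (use assms(3) t in auto)
    then show ?thesis using riccati_zero_between_regular[of t y] assms t q by (meson order_less_trans)
  qed
qed

section \<open>Signs of the Riccati defect near infinity\<close>


text \<open>Otherwise the defect is negative from some point on, and \<open>u' < - (1 + u^2)\<close> makes \<open>arctan u\<close> decrease
  without bound.\<close>

lemma defect_positive_at_top: "\<forall>\<^sub>F x in at_top. on_reals (riccati_defect u) x > 0"
proof -
  obtain X0 where X0: "\<And>x. x \<ge> X0 \<Longrightarrow> x \<notin> real_poles u"
    using eventually_regular_at_top unfolding eventually_at_top_linorder by auto
  define X where "X = max X0 2"
  have X: "x \<notin> real_poles u" "x \<ge> 2" if "x \<ge> X" for x
    using that X0 by (auto simp: X_def)
  have "on_reals (riccati_defect u) x > 0" if "x \<ge> X" for x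
  proof (rule ccontr)
    assume "\<not> ?thesis"
    then have neg: "on_reals (riccati_defect u) t < 0" if "t > x" for t
      using defect_stays_negative[of x t] X \<open>x \<ge> X\<close> that by force
    \<comment> \<open>an interval of length \<open>4 > pi\<close> exceeds the range of \<open>arctan\<close>\<close>
    have "arctan (on_reals u (x + 5)) + (x + 5) \<le> arctan (on_reals u (x + 1)) + (x + 1)"
    proof (rule DERIV_nonpos_imp_nonincreasing[where f = "\<lambda>t. arctan (on_reals u t) + t"])
      fix t assume t: "x + 1 \<le> t" "t \<le> x + 5"
      have t': "t \<notin> real_poles u" "t \<ge> 2" using X t \<open>x \<ge> X\<close> by auto
      define D where "D = (on_reals (riccati_defect u) t - t) / 2 - on_reals u t ^ 2"
      have "D \<le> - (1 + on_reals u t ^ 2)"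
        using neg[of t] t t' by (simp add: D_def)
      then have "D / (1 + on_reals u t ^ 2) \<le> - 1"
        by (subst pos_divide_le_eq) (auto simp: add_pos_nonneg)
      moreover have "((\<lambda>t. arctan (on_reals u t) + t) has_real_derivative D / (1 + on_reals u t ^ 2) + 1) (at t)"
        using deriv_on_reals[OF t'(1)] unfolding D_def[symmetric]
        by (auto intro!: derivative_eq_intros simp: divide_inverse mult.commute)
      ultimately show "\<exists>y. ((\<lambda>t. arctan (on_reals u t) + t) has_real_derivative y) (at t) \<and> y \<le> 0"
        by (intro exI conjI) auto
    qed simp
    moreover have "arctan (on_reals u (x + 5)) > - (pi / 2)" "arctan (on_reals u (x + 1)) < pi / 2"
      using arctan_bounded by auto
    ultimately show False using pi_less_4 by linarith
  qed
  then show ?thesis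
    unfolding eventually_at_top_linorder by blast
qed

text \<open>Once nonpositive, the defect stays negative up to the first pole; hence it is either positive near
  \<open>-\<infinity>\<close> or negative on a whole ray without poles.\<close>

lemma defect_sign_at_bot:
  "(\<forall>\<^sub>F x in at_bot. on_reals (riccati_defect u) x < 0) \<or>
   (\<forall>\<^sub>F x in at_bot. on_reals (riccati_defect u) x > 0)"
proof (cases "\<forall>\<^sub>F x in at_bot. on_reals (riccati_defect u) x > 0")
  case False
  obtain X where X: "\<And>x. x \<le> X \<Longrightarrow> x \<notin> real_poles u"
    using eventually_regular_at_bot unfolding eventually_at_bot_linorder by auto
  have "on_reals (riccati_defect u) y < 0" if "y \<le> X" for y
  proof -
    obtain x where "x \<le> y - 1" "on_reals (riccati_defect u) x \<le> 0"
      using False unfolding eventually_at_bot_linorder by (auto simp: not_less)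
    then show ?thesis
      using defect_stays_negative[of x y] X that by force
  qed
  then show ?thesis unfolding eventually_at_bot_linorder by blast
qed simp

text \<open>Suppose the defect \<open>r\<close> is positive. Since \<open>v' = (r - x) / 2 - v^2\<close> with \<open>- x / 2\<close> large, \<open>v\<close> has slope
  at least \<open>1\<close> as long as \<open>0 \<le> v \<le> M\<close>, so \<open>v\<close> becomes negative when \<open>x\<close> decreases, and remains negative by
  comparison. Then in the variable \<open>y = - x\<close> the function \<open>r\<close> increases at least at the rate \<open>2 \<alpha> - 1\<close> and
  satisfies \<open>r'' \<ge> r^2\<close>, so it blows up.\<close>

lemma defect_not_positive_at_bot:
  assumes bdd: "\<forall>\<^sub>F x in at_bot. on_reals u x \<le> M"
  shows "\<not> (\<forall>\<^sub>F x in at_bot. on_reals (riccati_defect u) x > 0)"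
proof
  assume "\<forall>\<^sub>F x in at_bot. on_reals (riccati_defect u) x > 0"
  with bdd eventually_regular_at_bot eventually_le_at_bot[of "- 2 * (M\<^sup>2 + 1)"]
  have "\<forall>\<^sub>F x in at_bot. x \<notin> real_poles u \<and> on_reals (riccati_defect u) x > 0 \<and>
      on_reals u x \<le> M \<and> x \<le> - 2 * (M\<^sup>2 + 1)"
    by eventually_elim simp
  then obtain X where X: "x \<notin> real_poles u" "on_reals (riccati_defect u) x > 0"
      "on_reals u x \<le> M" "x \<le> - 2 * (M\<^sup>2 + 1)" if "x \<le> X" for x
    unfolding eventually_at_bot_linorder by blast
  define r where "r = on_reals (riccati_defect u)"
  define v where "v = on_reals u"
  have dv: "(v has_real_derivative (r x - x) / 2 - v x ^ 2) (at x)" if "x \<le> X" for x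
    unfolding v_def r_def using X(1)[OF that] by (rule deriv_on_reals)
  have dr: "(r has_real_derivative 2 * v x * r x - (2 * \<alpha> - 1)) (at x)" if "x \<le> X" for x
    unfolding v_def r_def using X(1)[OF that] by (rule deriv_on_reals_defect)
  have rpos: "r x > 0" and vM: "v x \<le> M" and xM: "- x / 2 \<ge> M\<^sup>2 + 1" if "x \<le> X" for x
    using X[OF that] by (auto simp: r_def v_def)
  have "\<exists>x \<le> X. v x < 0"
  proof (rule ccontr)
    assume "\<not> ?thesis"
    then have nn: "v x \<ge> 0" if "x \<le> X" for x using that by force
    have M: "M \<ge> 0" using nn[of X] vM[of X] by simp
    have "v (X - M - 1) - (X - M - 1) \<le> v X - X"
    proof (rule DERIV_nonneg_imp_nondecreasing[where f = "\<lambda>t. v t - t"])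
      fix t assume t: "t \<le> X"
      have "v t ^ 2 \<le> M ^ 2" using nn[OF t] vM[OF t] by (intro power_mono)
      then have "(r t - t) / 2 - v t ^ 2 - 1 \<ge> 0"
        using rpos[OF t] xM[OF t] by (simp add: field_simps)
      then show "\<exists>y. ((\<lambda>t. v t - t) has_real_derivative y) (at t) \<and> 0 \<le> y"
        by (intro exI[of _ "(r t - t) / 2 - v t ^ 2 - 1"] conjI DERIV_diff dv[OF t] DERIV_ident)
    qed (use M in simp)
    then show False using nn[of "X - M - 1"] vM[of X] M by simp
  qed
  then obtain x0 where x0: "x0 \<le> X" "v x0 < 0" by blast
  have vneg: "v x < 0" if "x \<le> x0" for x
  proof (rule ccontr)
    assume c: "\<not> ?thesis"
    then have "x < x0" using that x0 by (cases "x = x0") auto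
    have "v x0 > 0"
    proof (rule linear_comparison[OF \<open>x < x0\<close>])
      show "continuous_on {x..x0} (\<lambda>t. - v t)"
        using x0(1)
        by (intro continuous_on_minus continuous_at_imp_continuous_on ballI DERIV_isCont[OF dv]) auto
      fix t assume "t \<in> {x..x0}"
      then have t: "t \<le> X" using x0 by auto
      show "(v has_real_derivative (r t - t) / 2 - v t ^ 2) (at t)" using dv[OF t] .
      have "M\<^sup>2 \<ge> 0" by simp
      with xM[OF t] have "t < 0"
        by linarith
      with rpos[OF t] have "(r t - t) / 2 > 0"
        by argo
      then show "- v t * v t < (r t - t) / 2 - v t ^ 2"
        by (simp add: power2_eq_square)
    qed (use c in simp)
    then show False using x0 by simp
  qed
  show False
  proof (rule quadratic_blowup[of "- x0"])
    fix y assume "- x0 \<le> y"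
    then have y: "- y \<le> x0" "- y \<le> X" using x0 by auto
    have neg: "((\<lambda>y. - y) has_real_derivative -1) (at y)"
      by (auto intro!: derivative_eq_intros)
    have drm: "((\<lambda>y. r (- y)) has_real_derivative - (2 * v (- y) * r (- y) - (2 * \<alpha> - 1))) (at y)"
      using DERIV_chain2[OF dr[OF y(2)] neg] by simp
    have dvm: "((\<lambda>y. v (- y)) has_real_derivative - ((r (- y) - (- y)) / 2 - v (- y) ^ 2)) (at y)"
      using DERIV_chain2[OF dv[OF y(2)] neg] by simp
    show "((\<lambda>y. r (- y)) has_real_derivative 2 * \<alpha> - 1 - 2 * v (- y) * r (- y)) (at y)"
      using drm by simp
    show "((\<lambda>y. 2 * \<alpha> - 1 - 2 * v (- y) * r (- y)) has_real_derivative
       r (- y) ^ 2 + y * r (- y) + 2 * v (- y) ^ 2 * r (- y) - 2 * v (- y) * (2 * \<alpha> - 1)) (at y)"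
      by (rule derivative_eq_intros drm dvm refl)+ (simp add: algebra_simps power2_eq_square)
    show "r (- y) > 0" using rpos[OF y(2)] .
    have *: "v (- y) * r (- y) \<le> 0"
      using vneg[OF y(1)] rpos[OF y(2)] by (simp add: mult_le_0_iff)
    then show "2 * \<alpha> - 1 - 2 * v (- y) * r (- y) \<ge> 2 * \<alpha> - 1"
      by (simp add: mult.commute)
    have "M\<^sup>2 \<ge> 0" by simp
    then have "y \<ge> 0" using xM[OF y(2)] by linarith
    then have "y * r (- y) \<ge> 0" "2 * v (- y) ^ 2 * r (- y) \<ge> 0" "2 * v (- y) * (2 * \<alpha> - 1) \<le> 0"
      using rpos[OF y(2)] vneg[OF y(1)] \<alpha> by (auto simp: mult_le_0_iff)
    then show "r (- y) ^ 2 + y * r (- y) + 2 * v (- y) ^ 2 * r (- y) - 2 * v (- y) * (2 * \<alpha> - 1) \<ge> r (- y) ^ 2"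
      by linarith
  qed (use \<alpha> in simp)
qed

lemma defect_negative_at_bot:
  assumes "\<forall>\<^sub>F x in at_bot. on_reals u x \<le> M"
  shows "\<forall>\<^sub>F x in at_bot. on_reals (riccati_defect u) x < 0"
  using defect_sign_at_bot defect_not_positive_at_bot[OF assms] by blast

end

end

section \<open>Alternating sets\<close>


text \<open>For disjoint finite sets: the merged increasing enumeration of \<open>A\<close> and \<open>B\<close> starts in \<open>A\<close> and switches between the two sets at
  every step. This form avoids enumerations, and it makes sense before the finiteness of \<open>B\<close> is known.\<close>

definition alternating :: "'a::linorder set \<Rightarrow> 'a set \<Rightarrow> bool" where
  "alternating A B \<longleftrightarrow>
     (\<forall>b\<in>B. \<exists>a\<in>A. a < b) \<and>
     (\<forall>a\<in>A. \<forall>a'\<in>A. a < a' \<longrightarrow> (\<exists>b\<in>B. a < b \<and> b < a')) \<and>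
     (\<forall>b\<in>B. \<forall>b'\<in>B. b < b' \<longrightarrow> (\<exists>a\<in>A. b < a \<and> a < b'))"

text \<open>Sending every element of \<open>B\<close> to the next element of \<open>A\<close> is a bijection onto \<open>A\<close> without its minimum.\<close>

lemma alternating_card:
  assumes alt: "alternating A B" and fin: "finite A" "A \<noteq> {}"
    and top: "\<And>b. b \<in> B \<Longrightarrow> \<exists>a\<in>A. b < a"
  shows "finite B" "card A = Suc (card B)"
proof -
  define next_A where "next_A b = Min {a \<in> A. b < a}" for b
  have next_A: "next_A b \<in> A" "b < next_A b" and least: "\<And>a. a \<in> A \<Longrightarrow> b < a \<Longrightarrow> next_A b \<le> a"
    if "b \<in> B" for b
  proof -
    have "next_A b \<in> {a \<in> A. b < a}"
      unfolding next_A_def by (rule Min_in) (use fin top[OF that] in auto)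
    then show "next_A b \<in> A" "b < next_A b" by auto
    show "next_A b \<le> a" if "a \<in> A" "b < a" for a
      unfolding next_A_def by (rule Min_le) (use fin that in auto)
  qed
  have lt: "next_A b < next_A b'" if b: "b \<in> B" "b' \<in> B" "b < b'" for b b'
  proof -
    obtain a where "a \<in> A" "b < a" "a < b'"
      using alt b unfolding alternating_def by blast
    then have "next_A b \<le> a" using least b by blast
    then show ?thesis using \<open>a < b'\<close> next_A(2)[OF b(2)] by simp
  qed
  have "inj_on next_A B"
  proof (rule inj_onI)
    fix b b' assume "b \<in> B" "b' \<in> B" "next_A b = next_A b'"
    then show "b = b'" using lt[of b b'] lt[of b' b] by (cases b b' rule: linorder_cases) auto
  qed
  moreover have "next_A ` B = A - {Min A}"
  proof (intro equalityI subsetI)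
    fix a assume "a \<in> next_A ` B"
    then obtain b where b: "b \<in> B" "a = next_A b" by blast
    obtain a' where "a' \<in> A" "a' < b"
      using alt b unfolding alternating_def by blast
    then have "Min A < a"
      using fin b next_A(2)[of b] Min_le[of A a'] by (meson le_less_trans less_trans)
    then show "a \<in> A - {Min A}" using next_A b by auto
  next
    fix a assume a: "a \<in> A - {Min A}"
    define C where "C = {c \<in> A. c < a}"
    have "Min A \<in> A" "Min A \<le> a" "Min A \<noteq> a"
      using a fin by auto
    then have "Min A \<in> C"
      unfolding C_def by (blast intro: order_le_neq_trans)
    moreover have "finite C"
      using fin by (simp add: C_def)
    ultimately have "Max C \<in> C"
      using Max_in by blast
    then have "Max C \<in> A" "Max C < a" by (auto simp: C_def)
    then obtain b where b: "b \<in> B" "Max C < b" "b < a"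
      using alt a unfolding alternating_def by blast
    have "next_A b = a"
    proof (rule ccontr)
      assume "next_A b \<noteq> a"
      then have "next_A b < a" using least[OF b(1), of a] a b by auto
      then have "next_A b \<in> C" using next_A[OF b(1)] by (simp add: C_def)
      then have "next_A b \<le> Max C" using fin by (intro Max_ge) (auto simp: C_def)
      then show False using b(2) next_A(2)[OF b(1)] by simp
    qed
    then show "a \<in> next_A ` B" using b by blast
  qed
  ultimately have bij: "bij_betw next_A B (A - {Min A})"
    by (simp add: bij_betw_def)
  then show "finite B" using fin bij_betw_finite by blast
  have "card B = card A - 1"
    using bij_betw_same_card[OF bij] fin by simp
  then show "card A = Suc (card B)"
    using fin by (simp add: card_gt_0_iff)
qed

lemma no_element_between_consecutive:
  assumes "finite S" "Suc i < card S" "x \<in> S"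
    "sorted_list_of_set S ! i < x" "x < sorted_list_of_set S ! Suc i"
  shows False
proof -
  define xs where "xs = sorted_list_of_set S"
  have len: "length xs = card S" and sorted: "sorted_wrt (<) xs" and set: "set xs = S"
    using assms(1) by (auto simp: xs_def)
  obtain k where k: "k < length xs" "x = xs ! k"
    using assms(3) set by (metis in_set_conv_nth)
  have mono: "xs ! a \<le> xs ! b" if "a \<le> b" "b < length xs" for a b
    using sorted_wrt_nth_less[OF sorted, of a b] that by (cases "a = b") auto
  have "\<not> k \<le> i" using mono[of k i] assms(2,4) k len by (auto simp: xs_def)
  moreover have "\<not> Suc i \<le> k" using mono[of "Suc i" k] assms(5) k by (auto simp: xs_def)
  ultimately show False by simp
qed

lemma alternating_nth:
  assumes alt: "alternating A B" and fin: "finite (A \<union> B)" and "i < card (A \<union> B)"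
  shows "if even i then sorted_list_of_set (A \<union> B) ! i \<in> A else sorted_list_of_set (A \<union> B) ! i \<in> B"
  using assms(3)
proof (induction i)
  define xs where "xs = sorted_list_of_set (A \<union> B)"
  have len: "length xs = card (A \<union> B)" and sorted: "sorted_wrt (<) xs" and set: "set xs = A \<union> B"
    using fin by (auto simp: xs_def)
  {
    case 0
    then have mem: "xs ! 0 \<in> A \<union> B" using len set nth_mem by metis
    have "xs ! 0 \<notin> B"
    proof
      assume "xs ! 0 \<in> B"
      then obtain a where a: "a \<in> A" "a < xs ! 0"
        using alt unfolding alternating_def by blast
      then obtain k where k: "k < length xs" "a = xs ! k"
        using set by (metis UnI1 in_set_conv_nth)
      then show False using a sorted_wrt_nth_less[OF sorted, of 0 k] by (cases k) auto
    qed
    then show ?case using mem by (simp add: xs_def)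
  next
    case (Suc i)
    have mem: "xs ! Suc i \<in> A \<union> B" using Suc.prems len set nth_mem by metis
    have lt: "xs ! i < xs ! Suc i"
      using sorted_wrt_nth_less[OF sorted, of i "Suc i"] Suc.prems len by simp
    have none: False if "x \<in> A \<union> B" "xs ! i < x" "x < xs ! Suc i" for x
      using no_element_between_consecutive[OF fin Suc.prems that(1)] that by (simp add: xs_def)
    show ?case
    proof (cases "even i")
      case True
      then have "xs ! i \<in> A" using Suc by (simp add: xs_def)
      then have "xs ! Suc i \<notin> A"
        using alt lt none unfolding alternating_def by blast
      then show ?thesis using mem True by (simp add: xs_def)
    next
      case False
      then have "xs ! i \<in> B" using Suc by (simp add: xs_def)
      then have "xs ! Suc i \<notin> B"
        using alt lt none unfolding alternating_def by blast
      then show ?thesis using mem False by (simp add: xs_def)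
    qed
  }
qed

text \<open>If the positions of the elements of \<open>A\<close> in the enumeration of \<open>S\<close> are the values of \<open>g\<close>, then \<open>g\<close>
  translates positions in \<open>A\<close> into positions in \<open>S\<close>. This links the poles of consecutive solutions, which
  share one residue class but differ in the other.\<close>

lemma sorted_list_of_subset_by_index:
  fixes A :: "'a::linorder set"
  assumes "finite S" "A \<subseteq> S" "strict_mono g"
    and idx: "\<And>i. i < card S \<Longrightarrow> sorted_list_of_set S ! i \<in> A \<longleftrightarrow> (\<exists>k. i = g k)"
    and "g k < card S"
  shows "sorted_list_of_set A ! k = sorted_list_of_set S ! g k"
proof -
  define xs where "xs = sorted_list_of_set S"
  have len: "length xs = card S" and sorted: "sorted_wrt (<) xs" and set: "set xs = S"
    using assms(1) by (auto simp: xs_def)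
  define m where "m = (LEAST m. card S \<le> g m)"
  have "\<exists>m. card S \<le> g m"
    using strict_mono_imp_increasing[OF assms(3), of "card S"] by blast
  then have gm: "card S \<le> g m" unfolding m_def by (rule LeastI_ex)
  have below: "g l < card S" if "l < m" for l
    using not_less_Least[of l "\<lambda>m. card S \<le> g m"] that by (simp add: m_def)
  have below_iff: "g l < card S \<longleftrightarrow> l < m" for l
    using below gm strict_mono_less_eq[OF assms(3), of m l] by (meson leD le_trans not_less)
  define ys where "ys = map (\<lambda>l. xs ! g l) [0..<m]"
  have "sorted_wrt (<) ys"
    unfolding ys_def sorted_wrt_map
  proof (rule sorted_wrt_mono_rel[OF _ sorted_wrt_upt])
    fix l l' assume "l \<in> set [0..<m]" "l' \<in> set [0..<m]" "l < l'"
    then show "xs ! g l < xs ! g l'"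
      using strict_mono_less[OF assms(3)] below len by (intro sorted_wrt_nth_less[OF sorted]) auto
  qed
  moreover have "set ys = A"
  proof (intro equalityI subsetI)
    fix y assume "y \<in> set ys"
    then obtain l where "l < m" "y = xs ! g l" by (auto simp: ys_def)
    then show "y \<in> A" using idx[OF below[of l]] by (auto simp: xs_def)
  next
    fix y assume y: "y \<in> A"
    then obtain i where i: "i < length xs" "y = xs ! i"
      using set assms(2) by (metis in_mono in_set_conv_nth)
    then obtain l where "i = g l" using idx[of i] y len by (auto simp: xs_def)
    then show "y \<in> set ys" using i below_iff[of l] len by (auto simp: ys_def)
  qed
  ultimately have "sorted_list_of_set A = ys"
    by (metis sorted_list_of_set.idem_if_sorted_distinct strict_sorted_iff)
  moreover have "k < m" using assms(5) below_iff by simp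
  ultimately show ?thesis by (simp add: ys_def xs_def)
qed

lemma alternating_sorted_list_of_set:
  fixes A B :: "'a::linorder set"
  assumes alt: "alternating A B" and fin: "finite (A \<union> B)" and disj: "A \<inter> B = {}"
  shows "2 * k < card (A \<union> B) \<Longrightarrow> sorted_list_of_set A ! k = sorted_list_of_set (A \<union> B) ! (2 * k)"
    and "2 * k + 1 < card (A \<union> B) \<Longrightarrow> sorted_list_of_set B ! k = sorted_list_of_set (A \<union> B) ! (2 * k + 1)"
proof -
  have *: "sorted_list_of_set (A \<union> B) ! i \<in> A \<longleftrightarrow> even i"
    "sorted_list_of_set (A \<union> B) ! i \<in> B \<longleftrightarrow> odd i" if "i < card (A \<union> B)" for i
    using alternating_nth[OF alt fin that] disj by (auto split: if_splits)
  show "2 * k < card (A \<union> B) \<Longrightarrow> sorted_list_of_set A ! k = sorted_list_of_set (A \<union> B) ! (2 * k)"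
    by (rule sorted_list_of_subset_by_index[where g = "\<lambda>k. 2 * k"])
      (use fin * in \<open>auto simp: strict_mono_def elim: evenE\<close>)
  show "2 * k + 1 < card (A \<union> B) \<Longrightarrow> sorted_list_of_set B ! k = sorted_list_of_set (A \<union> B) ! (2 * k + 1)"
    by (rule sorted_list_of_subset_by_index[where g = "\<lambda>k. 2 * k + 1"])
      (use fin * in \<open>auto simp: strict_mono_def elim: oddE\<close>)
qed

section \<open>Alternation of the residues\<close>


context
  fixes \<alpha> :: real and u :: "complex \<Rightarrow> complex"
  assumes u: "real_PII_solution \<alpha> u" and fin: "finite (real_poles u)" and \<alpha>: "\<alpha> > 1 / 2"
begin

lemma pick_near_plus_pole:
  assumes "p \<in> plus_poles u"
  shows "a < p \<Longrightarrow> \<exists>t. a < t \<and> t < p \<and> t \<notin> real_poles u \<and> on_reals (riccati_defect u) t < 0"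
    and "p < b \<Longrightarrow> \<exists>t. p < t \<and> t < b \<and> t \<notin> real_poles u \<and> on_reals (riccati_defect u) t > 0"
  using eventually_at_pick[OF near_plus_pole[OF u fin \<alpha> assms]]
  by (fastforce simp: sgn_real_def split: if_splits)+

lemma pick_near_riccati_zero:
  assumes "z \<in> riccati_zeros u"
  shows "a < z \<Longrightarrow> \<exists>t. a < t \<and> t < z \<and> t \<notin> real_poles u \<and> on_reals (riccati_defect u) t > 0"
    and "z < b \<Longrightarrow> \<exists>t. z < t \<and> t < b \<and> t \<notin> real_poles u \<and> on_reals (riccati_defect u) t < 0"
  using eventually_at_pick[OF near_riccati_zero[OF u fin \<alpha> assms]]
  by (fastforce simp: sgn_real_def split: if_splits)+

lemma plus_pole_before:
  assumes "\<forall>\<^sub>F x in at_bot. on_reals (riccati_defect u) x < 0"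
    and t: "t \<notin> real_poles u" "on_reals (riccati_defect u) t > 0"
  shows "\<exists>p \<in> plus_poles u. p < t"
proof -
  have "\<forall>\<^sub>F x in at_bot. x < t \<and> x \<notin> real_poles u \<and> on_reals (riccati_defect u) x < 0"
    using assms(1) eventually_regular_at_bot[OF u fin] eventually_gt_at_bot[of t]
    by eventually_elim simp
  then obtain x where "x < t" "x \<notin> real_poles u" "on_reals (riccati_defect u) x < 0"
    by (metis (mono_tags, lifting) eventually_happens' trivial_limit_at_bot_linorder)
  then show ?thesis
    using plus_pole_between[OF u fin \<alpha>, of x t] t by blast
qed

lemma plus_pole_after:
  assumes t: "t \<notin> real_poles u" "on_reals (riccati_defect u) t < 0"
  shows "\<exists>p \<in> plus_poles u. t < p"
proof -
  have "\<forall>\<^sub>F x in at_top. t < x \<and> x \<notin> real_poles u \<and> on_reals (riccati_defect u) x > 0"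
    using defect_positive_at_top[OF u fin \<alpha>] eventually_regular_at_top[OF u fin] eventually_gt_at_top[of t]
    by eventually_elim simp
  then obtain x where "t < x" "x \<notin> real_poles u" "on_reals (riccati_defect u) x > 0"
    by (metis (mono_tags, lifting) eventually_happens' trivial_limit_at_top_linorder)
  then show ?thesis
    using plus_pole_between[OF u fin \<alpha>, of t x] t by blast
qed

lemma plus_pole_after_riccati_zero:
  assumes "z \<in> riccati_zeros u"
  shows "\<exists>p \<in> plus_poles u. z < p"
proof -
  obtain t where "z < t" "t \<notin> real_poles u" "on_reals (riccati_defect u) t < 0"
    using pick_near_riccati_zero(2)[OF assms, of "z + 1"] by auto
  then show ?thesis
    using plus_pole_after[of t] by (meson order_less_trans)
qed

lemma riccati_zero_between_plus_poles:
  assumes "p \<in> plus_poles u" "p' \<in> plus_poles u" "p < p'"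
  shows "\<exists>z \<in> riccati_zeros u. p < z \<and> z < p'"
proof -
  obtain t where t: "p < t" "t < p'" "t \<notin> real_poles u" "on_reals (riccati_defect u) t > 0"
    using pick_near_plus_pole(2)[OF assms(1,3)] by blast
  obtain t' where t': "t < t'" "t' < p'" "t' \<notin> real_poles u" "on_reals (riccati_defect u) t' < 0"
    using pick_near_plus_pole(1)[OF assms(2) t(2)] by blast
  show ?thesis
    using riccati_zero_between[OF u fin \<alpha> t'(1) t(3) t'(3) t(4) t'(4)] t t' by (meson order_less_trans)
qed

lemma riccati_zero_between_minus_plus:
  assumes "d \<in> minus_poles u" "p \<in> plus_poles u" "d < p"
  shows "\<exists>z \<in> riccati_zeros u. d < z \<and> z < p"
proof -
  obtain t where t: "d < t" "t < p" "t \<notin> real_poles u" "on_reals (riccati_defect u) t > 0"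
    using eventually_at_pick(2)[OF defect_positive_near_minus_pole[OF u fin assms(1)] assms(3)] by blast
  obtain t' where t': "t < t'" "t' < p" "t' \<notin> real_poles u" "on_reals (riccati_defect u) t' < 0"
    using pick_near_plus_pole(1)[OF assms(2) t(2)] by blast
  show ?thesis
    using riccati_zero_between[OF u fin \<alpha> t'(1) t(3) t'(3) t(4) t'(4)] t t' by (meson order_less_trans)
qed

lemma plus_pole_between_zero_minus:
  assumes "z \<in> riccati_zeros u" "d \<in> minus_poles u" "z < d"
  shows "\<exists>p \<in> plus_poles u. z < p \<and> p < d"
proof -
  obtain t where t: "z < t" "t < d" "t \<notin> real_poles u" "on_reals (riccati_defect u) t < 0"
    using pick_near_riccati_zero(2)[OF assms(1,3)] by blast
  obtain t' where t': "t < t'" "t' < d" "t' \<notin> real_poles u" "on_reals (riccati_defect u) t' > 0"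
    using eventually_at_pick(1)[OF defect_positive_near_minus_pole[OF u fin assms(2)] t(2)] by blast
  show ?thesis
    using plus_pole_between[OF u fin \<alpha> t'(1) t(3) t'(3) t(4) t'(4)] t t' by (meson order_less_trans)
qed

lemma plus_pole_between_riccati_zeros:
  assumes "z \<in> riccati_zeros u" "z' \<in> riccati_zeros u" "z < z'"
  shows "\<exists>p \<in> plus_poles u. z < p \<and> p < z'"
proof -
  obtain t where t: "z < t" "t < z'" "t \<notin> real_poles u" "on_reals (riccati_defect u) t < 0"
    using pick_near_riccati_zero(2)[OF assms(1,3)] by blast
  obtain t' where t': "t < t'" "t' < z'" "t' \<notin> real_poles u" "on_reals (riccati_defect u) t' > 0"
    using pick_near_riccati_zero(1)[OF assms(2) t(2)] by blast
  show ?thesis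
    using plus_pole_between[OF u fin \<alpha> t'(1) t(3) t'(3) t(4) t'(4)] t t' by (meson order_less_trans)
qed

context
  assumes neg: "\<forall>\<^sub>F x in at_bot. on_reals (riccati_defect u) x < 0"
begin

lemma plus_pole_before_minus_pole:
  assumes "d \<in> minus_poles u"
  shows "\<exists>p \<in> plus_poles u. p < d"
proof -
  obtain t where "t < d" "t \<notin> real_poles u" "on_reals (riccati_defect u) t > 0"
    using eventually_at_pick(1)[OF defect_positive_near_minus_pole[OF u fin assms], of "d - 1"] by auto
  then show ?thesis
    using plus_pole_before[OF neg, of t] by (meson order_less_trans)
qed

lemma plus_poles_alternate_riccati_zeros: "alternating (plus_poles u) (riccati_zeros u)"
proof -
  have "\<exists>p \<in> plus_poles u. p < z" if z: "z \<in> riccati_zeros u" for z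
  proof -
    obtain t where "t < z" "t \<notin> real_poles u" "on_reals (riccati_defect u) t > 0"
      using pick_near_riccati_zero(1)[OF z, of "z - 1"] by auto
    then show ?thesis
      using plus_pole_before[OF neg, of t] by (meson order_less_trans)
  qed
  then show ?thesis
    unfolding alternating_def
    using riccati_zero_between_plus_poles plus_pole_between_riccati_zeros by blast
qed

text \<open>The hypothesis is the alternation of the poles of the inverse Backlund transform. Of the defining
  properties only one is not immediate from the sign changes of the defect, namely that two poles \<open>p < p'\<close> of
  residue \<open>1\<close> are separated by one of residue \<open>-1\<close>. They are separated by a zero \<open>z\<close> of the defect; the
  hypothesis gives a pole \<open>d\<close> of residue \<open>-1\<close> before \<open>z\<close> and after all zeros that precede \<open>p\<close>. It cannot lie
  before \<open>p\<close>, since the defect is positive at \<open>d\<close> and negative just before \<open>p\<close>, which needs a further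
  zero in between.\<close>

lemma alternating_lift:
  assumes "alternating (minus_poles u) (riccati_zeros u)" and finZ: "finite (riccati_zeros u)"
  shows "alternating (plus_poles u) (minus_poles u)"
proof -
  have "\<exists>d \<in> minus_poles u. p < d \<and> d < p'" if p: "p \<in> plus_poles u" "p' \<in> plus_poles u" "p < p'" for p p'
  proof -
    obtain z where z: "z \<in> riccati_zeros u" "p < z" "z < p'"
      using riccati_zero_between_plus_poles[OF p] by blast
    \<comment> \<open>the zeros before \<open>p\<close>; if there are none, any pole of residue \<open>-1\<close> before \<open>z\<close> will do\<close>
    define Z where "Z = {z0 \<in> riccati_zeros u. z0 < p}"
    have finZ': "finite Z" using finZ by (simp add: Z_def)
    have "\<exists>d \<in> minus_poles u. d < z \<and> (\<forall>z0 \<in> Z. z0 < d)"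
    proof (cases "Z = {}")
      case True
      then show ?thesis using assms(1) z(1) unfolding alternating_def by blast
    next
      case False
      then have "Max Z \<in> Z" using finZ' by (rule Max_in[rotated])
      then have "Max Z \<in> riccati_zeros u" "Max Z < z" using z by (auto simp: Z_def)
      then obtain d where "d \<in> minus_poles u" "Max Z < d" "d < z"
        using assms(1) z(1) unfolding alternating_def by blast
      then show ?thesis
        using Max_ge[OF finZ'] by (meson le_less_trans)
    qed
    then obtain d where d: "d \<in> minus_poles u" "d < z" "\<And>z0. z0 \<in> Z \<Longrightarrow> z0 < d" by blast
    have "p < d"
    proof (rule ccontr)
      assume "\<not> p < d"
      moreover have "d \<noteq> p" using d(1) p(1) plus_minus_poles_disjoint by blast
      ultimately have "d < p" by simp
      then obtain z0 where "z0 \<in> riccati_zeros u" "d < z0" "z0 < p"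
        using riccati_zero_between_minus_plus[OF d(1) p(1)] by blast
      then show False using d(3)[of z0] by (simp add: Z_def)
    qed
    then show ?thesis using d z by (meson order_less_trans)
  qed
  moreover have "\<exists>p \<in> plus_poles u. d < p \<and> p < d'" if d: "d \<in> minus_poles u" "d' \<in> minus_poles u" "d < d'" for d d'
  proof -
    obtain z where z: "z \<in> riccati_zeros u" "d < z" "z < d'"
      using assms(1) d unfolding alternating_def by blast
    then show ?thesis
      using plus_pole_between_zero_minus[OF z(1) d(2)] by (meson order_less_trans)
  qed
  ultimately show ?thesis
    unfolding alternating_def using plus_pole_before_minus_pole by blast
qed

end

end

lemma backlund_down_pole_sets:
  assumes "PII_solution \<alpha> u" "PII_solution \<beta> w" "backlund_down \<alpha> u w" "\<alpha> \<noteq> 1 / 2"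
  shows "plus_poles w = minus_poles u" "minus_poles w = riccati_zeros u"
  using backlund_down_residue_one_iff[OF assms] backlund_down_residue_minus_one_iff[OF assms]
  by (auto simp: plus_poles_def minus_poles_def riccati_zeros_def)

text \<open>If the defect of \<open>w\<close> were positive, then \<open>4 w'\<close>, which is the defect of \<open>w\<close> minus that of \<open>u\<close>, would be
  positive as well. So \<open>w\<close> would be increasing, hence bounded above near \<open>-\<infinity>\<close>, which excludes a positive
  defect.\<close>

lemma backlund_down_defect_negative_at_bot:
  assumes u: "real_PII_solution \<alpha> u" "finite (real_poles u)" and \<alpha>: "\<alpha> > 3 / 2"
    and w: "real_PII_solution (\<alpha> - 1) w" "finite (real_poles w)" and uw: "backlund_down \<alpha> u w"
    and neg: "\<forall>\<^sub>F x in at_bot. on_reals (riccati_defect u) x < 0"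
  shows "\<forall>\<^sub>F x in at_bot. on_reals (riccati_defect w) x < 0"
proof -
  have \<alpha>': "\<alpha> - 1 > 1 / 2" using \<alpha> by simp
  consider "\<forall>\<^sub>F x in at_bot. on_reals (riccati_defect w) x < 0"
    | "\<forall>\<^sub>F x in at_bot. on_reals (riccati_defect w) x > 0"
    using defect_sign_at_bot[OF w \<alpha>'] by blast
  then show ?thesis
  proof cases
    case 2
    with neg eventually_regular_at_bot[OF u] eventually_regular_at_bot[OF w]
    have "\<forall>\<^sub>F x in at_bot. x \<notin> real_poles w \<and> on_reals (deriv w) x > 0"
    proof eventually_elim
      case (elim x)
      have 1: "2 * w (of_real x) ^ 2 - 2 * deriv w (of_real x) + of_real x = riccati_defect u (of_real x)"
        using \<alpha> elim
        by (intro backlund_down_riccati_defect[OF PII_solution_of_real[OF u] uw] real_regular_analytic[OF u]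
            real_regular_analytic[OF w]) auto
      have 2: "riccati_defect w (of_real x) = 2 * w (of_real x) ^ 2 + 2 * deriv w (of_real x) + of_real x"
        by (simp add: riccati_defect_def)
      have "4 * deriv w (of_real x) = riccati_defect w (of_real x) - riccati_defect u (of_real x)"
        unfolding 2 1 [symmetric] by simp
      then have "4 * on_reals (deriv w) x = on_reals (riccati_defect w) x - on_reals (riccati_defect u) x"
        by (simp add: on_reals_def complex_eq_iff)
      then show ?case using elim by simp
    qed
    then obtain X where X: "\<And>x. x \<le> X \<Longrightarrow> x \<notin> real_poles w" "\<And>x. x \<le> X \<Longrightarrow> on_reals (deriv w) x > 0"
      unfolding eventually_at_bot_linorder by blast
    have "on_reals w x \<le> on_reals w X" if "x \<le> X" for x
    proof (rule DERIV_nonneg_imp_nondecreasing[where f = "on_reals w", OF that])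
      fix t assume "t \<le> X"
      then show "\<exists>y. (on_reals w has_real_derivative y) (at t) \<and> 0 \<le> y"
        using has_derivative_on_reals[OF analytic_derivI[OF real_regular_analytic[OF w X(1)]]]
          X(2)[of t] by (intro exI[of _ "on_reals (deriv w) t"]) (auto simp: on_reals_def)
    qed
    then have "\<forall>\<^sub>F x in at_bot. on_reals w x \<le> on_reals w X"
      unfolding eventually_at_bot_linorder by blast
    then show ?thesis by (rule defect_negative_at_bot[OF w \<alpha>'])
  qed
qed

text \<open>Induction on the number of real poles by an inverse Backlund step. With \<open>P\<close>, \<open>D\<close> the poles of residue
  \<open>1\<close> and \<open>-1\<close> and \<open>Z\<close> the zeros of the defect at regular points, \<open>P\<close> and \<open>Z\<close> alternate and both start and
  end with \<open>P\<close>, so that \<open>card P = card Z + 1\<close>. The poles of the transform are \<open>D\<close> and \<open>Z\<close>: one less. The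
  bound on \<open>\<alpha>\<close> is passed on, and it guarantees \<open>\<alpha> > 1 / 2\<close> as long as there is a pole; without poles
  nothing is to be shown, so negativity near \<open>-\<infinity>\<close> is required for \<open>\<alpha> > 1 / 2\<close> only.\<close>

lemma real_poles_alternate:
  assumes "real_PII_solution \<alpha> u" "finite (real_poles u)" "\<alpha> > real (card (real_poles u)) - 1 / 2"
    and "\<alpha> > 1 / 2 \<Longrightarrow> \<forall>\<^sub>F x in at_bot. on_reals (riccati_defect u) x < 0"
  shows "alternating (plus_poles u) (minus_poles u)"
  using assms
proof (induction "card (real_poles u)" arbitrary: \<alpha> u)
  case 0
  have "PII_solution \<alpha> u" using 0 by (simp add: real_PII_solution_def)
  moreover have "real_poles u = {}" using 0 by simp
  ultimately have "plus_poles u = {}" "minus_poles u = {}"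
    using real_poles_eq by blast+
  then show ?case by (simp add: alternating_def)
next
  case (Suc m)
  note u = Suc.prems(1,2)
  have \<alpha>: "\<alpha> > 1 / 2" using Suc.prems(3) Suc.hyps(2)[symmetric] by simp
  note neg = Suc.prems(4)[OF \<alpha>]
  have PII: "PII_solution \<alpha> u" using u by (simp add: real_PII_solution_def)
  obtain w where w: "real_PII_solution (\<alpha> - 1) w" and down: "backlund_down \<alpha> u w"
    using real_PII_solution_backlund_down[OF u(1)] \<alpha> by auto
  have PIIw: "PII_solution (\<alpha> - 1) w" using w by (simp add: real_PII_solution_def)
  have sets: "plus_poles w = minus_poles u" "minus_poles w = riccati_zeros u"
    using backlund_down_pole_sets[OF PII PIIw down] \<alpha> by auto
  have finP: "finite (plus_poles u)" and finD: "finite (minus_poles u)"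
    using u(2) real_poles_eq[OF PII] by auto
  have "plus_poles u \<noteq> {}"
  proof
    assume "plus_poles u = {}"
    then have "minus_poles u = {}" using plus_pole_before_minus_pole[OF u \<alpha> neg] by blast
    then have "real_poles u = {}" using \<open>plus_poles u = {}\<close> real_poles_eq[OF PII] by simp
    then show False using Suc.hyps(2) by simp
  qed
  note count = alternating_card[OF plus_poles_alternate_riccati_zeros[OF u \<alpha> neg] finP this
      plus_pole_after_riccati_zero[OF u \<alpha>]]
  have finw: "finite (real_poles w)"
    using real_poles_eq[OF PIIw] sets finD count(1) by simp
  have "card (real_poles w) = card (minus_poles u) + card (riccati_zeros u)"
    using real_poles_eq[OF PIIw] sets finD count(1) plus_minus_poles_disjoint[of w]
    by (simp add: card_Un_disjoint)
  moreover have "card (real_poles u) = card (plus_poles u) + card (minus_poles u)"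
    using real_poles_eq[OF PII] finP finD plus_minus_poles_disjoint[of u] by (simp add: card_Un_disjoint)
  ultimately have m: "m = card (real_poles w)"
    using Suc.hyps(2) count(2) by simp
  have "alternating (plus_poles w) (minus_poles w)"
  proof (rule Suc.hyps(1)[OF m w finw])
    show "\<alpha> - 1 > real (card (real_poles w)) - 1 / 2"
      using Suc.prems(3) Suc.hyps(2)[symmetric] m by simp
    show "\<forall>\<^sub>F x in at_bot. on_reals (riccati_defect w) x < 0" if "\<alpha> - 1 > 1 / 2"
      using backlund_down_defect_negative_at_bot[OF u _ w finw down neg] that by simp
  qed
  then show ?case
    unfolding sets using alternating_lift[OF u \<alpha> neg] count(1) by blast
qed

section \<open>Quasi-Ablowitz-Segur and quasi-Hastings-McLeod sequences\<close>


lemma qAS_solution_bounded_above_at_bot: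
  assumes "qAS_solution b \<alpha> k u"
  obtains M where "\<forall>\<^sub>F x in at_bot. on_reals u x \<le> M"
proof -
  define wave where "wave x = qAS_d \<alpha> k / (- x) powr (1/4)
      * cos (2/3 * (- x) powr (3/2) - 3/4 * (qAS_d \<alpha> k)\<^sup>2 * ln (- x) + qAS_phi \<alpha> k)" for x
  have "(\<lambda>x. on_reals u x - wave x) \<in> O[at_bot](\<lambda>x. 1 / \<bar>x\<bar>)"
    using assms by (simp add: qAS_solution_def wave_def on_reals_def)
  then obtain c where c: "c > 0"
    "\<forall>\<^sub>F x in at_bot. norm (on_reals u x - wave x) \<le> c * norm (1 / \<bar>x\<bar>)"
    by (rule landau_o.bigE)
  have "\<forall>\<^sub>F x in at_bot. on_reals u x \<le> \<bar>qAS_d \<alpha> k\<bar> + c"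
    using c(2) eventually_le_at_bot[of "-1"]
  proof eventually_elim
    case (elim x)
    have "1 \<le> (- x) powr (1/4)"
      using elim(2) by (intro ge_one_powr_ge_zero) auto
    then have "\<bar>wave x\<bar> \<le> \<bar>qAS_d \<alpha> k\<bar> * 1"
      unfolding wave_def abs_mult by (intro mult_mono) (auto simp: divide_le_eq mult_le_cancel_left1)
    moreover have "norm (1 / \<bar>x\<bar>) \<le> 1"
      using elim(2) divide_left_mono[of 1 "\<bar>x\<bar>" 1] by simp
    then have "c * norm (1 / \<bar>x\<bar>) \<le> c * 1"
      using c(1) by (intro mult_left_mono) auto
    ultimately show ?case
      using elim(1) by auto
  qed
  then show ?thesis using that by blast
qed

lemma qHM_solution_bounded_above_at_bot:
  assumes "qHM_solution b \<alpha> u"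
  obtains M where "\<forall>\<^sub>F x in at_bot. on_reals u x \<le> M"
proof -
  define f where "f x = - sqrt (- x / 2) - \<alpha> / (2 * x)" for x
  have "(\<lambda>x. on_reals u x - f x) \<in> O[at_bot](\<lambda>x. (- x) powr (-3/2))"
    using assms by (simp add: qHM_solution_def f_def on_reals_def)
  then obtain c where c: "c > 0"
    "\<forall>\<^sub>F x in at_bot. norm (on_reals u x - f x) \<le> c * norm ((- x) powr (-3/2))"
    by (rule landau_o.bigE)
  have "\<forall>\<^sub>F x in at_bot. on_reals u x \<le> \<bar>\<alpha>\<bar> + c"
    using c(2) eventually_le_at_bot[of "-1"]
  proof eventually_elim
    case (elim x)
    have "(- x) powr (-3/2) \<le> 1"
      using elim(2) powr_mono[of "-3/2" 0 "- x"] by simp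
    then have "c * norm ((- x) powr (-3/2)) \<le> c"
      using c(1) by simp
    moreover have "f x \<le> \<bar>\<alpha>\<bar>"
    proof -
      have "\<bar>\<alpha> / (2 * x)\<bar> \<le> \<bar>\<alpha>\<bar>"
        unfolding abs_divide using elim(2) divide_left_mono[of 1 "\<bar>2 * x\<bar>" "\<bar>\<alpha>\<bar>"] by simp
      moreover have "sqrt (- x / 2) \<ge> 0" using elim(2) by simp
      ultimately show ?thesis unfolding f_def by linarith
    qed
    ultimately show ?case
      using elim(1) by auto
  qed
  then show ?thesis using that by blast
qed

theorem theorem2:
  fixes n :: nat and \<alpha> :: real
    and B :: "real \<Rightarrow> real \<Rightarrow> real"
    and u :: "nat \<Rightarrow> complex \<Rightarrow> complex"
  defines "p \<equiv> \<lambda>j. nth_real_pole (u j)"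
    and "res \<equiv> \<lambda>j. nth_real_residue (u j)"
  assumes n: "n \<ge> 1"
    and \<alpha>: "\<alpha> \<in> {real n - 1/2 <..< real n + 1/2}"
    and B: "\<And>\<beta>. has_B_expansion \<beta> (B \<beta>)"
    and u: "(\<exists>k \<in> {- \<bar>cos (pi * \<alpha>)\<bar> <..< \<bar>cos (pi * \<alpha>)\<bar>}.
               \<forall>j. qAS_solution (B (\<alpha> + real j)) (\<alpha> + real j) ((-1) ^ j * k) (u j))
            \<or> (\<forall>j. qHM_solution (B (\<alpha> + real j)) (\<alpha> + real j) (u j))"
    and Backlund: "\<And>j. Backlund_related (\<alpha> + real j) (u j) (u (Suc j))"
    and pole_count: "\<And>j. card (real_poles (u j)) = n + j"
  shows
    \<comment> \<open>(a)\<close>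
    "(\<forall>j. res j 1 = 1 \<and> p j 1 > p (Suc j) 1)
     \<and> \<comment> \<open>(b)\<close>
     ((\<forall>i \<in> {1..<n}. p 0 i < p 0 (Suc i)) \<and>
      (\<forall>i \<in> {1..n}. res 0 i = (if odd i then 1 else -1)))
     \<and> \<comment> \<open>(c)\<close>
     ((\<forall>z. is_pole (u 0) z \<and> residue (u 0) z = 1 \<longrightarrow>
           is_pole (u 1) z \<and> residue (u 1) z = -1) \<and>
      (\<forall>i \<in> {1..n}. res 0 i = 1 \<longrightarrow> p 1 (Suc i) = p 0 i \<and> res 1 (Suc i) = -1) \<and>
      (\<forall>z. is_pole (u 0) z \<and> residue (u 0) z = -1 \<longrightarrow> u 1 analytic_on {z}))
     \<and> \<comment> \<open>(d)\<close>
     ((\<forall>j. res j (n + j) = (if odd (n + j) then 1 else -1)) \<and>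
      (\<forall>j. if odd (n + j)
           then p j (n + j) = p (Suc j) (n + Suc j)
           else p j (n + j) < p (Suc j) (n + Suc j)))"
proof -
  have real: "real_PII_solution (\<alpha> + real j) (u j)" for j
    using u by (auto simp: qAS_solution_def qHM_solution_def)
  then have PII: "PII_solution (\<alpha> + real j) (u j)" for j
    by (simp add: real_PII_solution_def)
  have fin: "finite (real_poles (u j))" for j
    using pole_count[of j] n by (intro card_ge_0_finite) simp
  have big: "\<alpha> + real j > real (n + j) - 1 / 2" for j
    using \<alpha> by simp
  have half: "\<alpha> + real j > 1 / 2" for j
    using \<alpha> n by simp
  have bounded: "\<exists>M. \<forall>\<^sub>F x in at_bot. on_reals (u j) x \<le> M" for j
    using u qAS_solution_bounded_above_at_bot qHM_solution_bounded_above_at_bot by metis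
  have neg: "\<forall>\<^sub>F x in at_bot. on_reals (riccati_defect (u j)) x < 0" for j
    using bounded[of j] defect_negative_at_bot[OF real fin half] by blast
  have alt: "alternating (plus_poles (u j)) (minus_poles (u j))" for j
    using real_poles_alternate[OF real fin _ neg] big pole_count by simp
  have down: "backlund_down (\<alpha> + real (Suc j)) (u (Suc j)) (u j)" for j
  proof -
    have eq: "\<alpha> + real (Suc j) = \<alpha> + real j + 1"
      by simp
    show ?thesis
      unfolding eq
      by (rule Backlund_related_imp_backlund_down[OF PII PII[of "Suc j", unfolded eq] Backlund])
        (use half[of j] in simp)
  qed
  have ne: "\<alpha> + real j \<noteq> 1 / 2" for j
    using half[of j] by simp
  note sets = backlund_down_pole_sets[OF PII PII down ne]
  note poles_eq = real_poles_eq[OF PII]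
  have card_Un: "card (plus_poles (u j) \<union> minus_poles (u j)) = n + j" for j
    using pole_count poles_eq by metis
  have fin_Un: "finite (plus_poles (u j) \<union> minus_poles (u j))" for j
    using fin poles_eq by metis
  have residues: "res j (Suc i) = (if even i then 1 else -1)" if "i < n + j" for i j
    using alternating_nth[OF alt[of j] fin_Un, of i] that
    unfolding res_def nth_real_residue_def nth_real_pole_def poles_eq[of j] card_Un
    by (auto simp: plus_poles_def minus_poles_def)
  have mono: "p j (Suc i) < p j (Suc i')" if "i < i'" "i' < n + j" for i i' j
    unfolding p_def nth_real_pole_def
    using that fin[of j] pole_count[of j] by (simp add: sorted_wrt_nth_less[OF strict_sorted_list_of_set])
  \<comment> \<open>the \<open>k\<close>-th pole of residue \<open>1\<close> of one solution is the \<open>k\<close>-th pole of residue \<open>-1\<close> of the next, counting from \<open>0\<close>\<close>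
  have shift: "p j (Suc (2 * k)) = p (Suc j) (Suc (Suc (2 * k)))" if "2 * k < n + j" for j k
  proof -
    have "sorted_list_of_set (plus_poles (u j)) ! k = sorted_list_of_set (real_poles (u j)) ! (2 * k)"
      unfolding poles_eq using that
      by (intro alternating_sorted_list_of_set(1)[OF alt fin_Un plus_minus_poles_disjoint])
        (simp add: card_Un)
    moreover have "sorted_list_of_set (minus_poles (u (Suc j))) ! k =
        sorted_list_of_set (real_poles (u (Suc j))) ! (2 * k + 1)"
      unfolding poles_eq using that
      by (intro alternating_sorted_list_of_set(2)[OF alt fin_Un plus_minus_poles_disjoint])
        (simp add: card_Un)
    ultimately show ?thesis
      by (simp add: p_def nth_real_pole_def sets(1)[of j])
  qed
  have a: "res j 1 = 1 \<and> p j 1 > p (Suc j) 1" for j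
    using residues[of 0 j] shift[of 0 j] mono[of 0 1 "Suc j"] n by simp
  have b1: "p 0 i < p 0 (Suc i)" if "i \<in> {1..<n}" for i
    using mono[of "i - 1" i 0] that by simp
  have b2: "res 0 i = (if odd i then 1 else -1)" if "i \<in> {1..n}" for i
    using residues[of "i - 1" 0] that by (cases i) auto
  have c1: "is_pole (u 1) z \<and> residue (u 1) z = -1" if "is_pole (u 0) z \<and> residue (u 0) z = 1" for z
    using backlund_down_residue_one_iff[OF PII PII down ne, of 0 z] that by simp
  have c2: "p 1 (Suc i) = p 0 i \<and> res 1 (Suc i) = -1" if "i \<in> {1..n}" "res 0 i = 1" for i
  proof -
    have "odd i" using b2[OF that(1)] that(2) by (auto split: if_splits)
    then obtain k where k: "i = Suc (2 * k)" by (auto elim: oddE)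
    then show ?thesis
      using shift[of k 0] residues[of i 1] that(1) by simp
  qed
  have c3: "u 1 analytic_on {z}" if "is_pole (u 0) z \<and> residue (u 0) z = -1" for z
    using backlund_down_residue_minus_one_iff[OF PII PII down ne, of 0 z] that
      PII_solution_analytic_at[OF PII, of 1 z] by simp
  have d1: "res j (n + j) = (if odd (n + j) then 1 else -1)" for j
    using residues[of "n + j - 1" j] n by (cases "n + j") auto
  have d2: "if odd (n + j) then p j (n + j) = p (Suc j) (n + Suc j)
            else p j (n + j) < p (Suc j) (n + Suc j)" for j
  proof (cases "odd (n + j)")
    case True
    then obtain k where "n + j = 2 * k + 1" by (rule oddE)
    then show ?thesis using shift[of k j] True by simp
  next
    case False
    define i where "i = n + j - 1"
    have i: "n + j = Suc i" "odd i" using n False by (auto simp: i_def)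
    \<comment> \<open>the last pole turns into a zero of the next defect, which is positive near \<open>+\<infinity>\<close> and so must cross again\<close>
    have "p j (n + j) \<in> minus_poles (u j)"
      using alternating_nth[OF alt[of j] fin_Un, of i] i
      unfolding p_def nth_real_pole_def poles_eq[of j] card_Un by simp
    then obtain q where q: "q \<in> plus_poles (u (Suc j))" "p j (n + j) < q"
      using plus_pole_after_riccati_zero[OF real fin half] sets(2) by blast
    then have "q \<in> set (sorted_list_of_set (real_poles (u (Suc j))))"
      using fin poles_eq by simp
    then obtain l where l: "l < n + Suc j" "q = p (Suc j) (Suc l)"
      by (auto simp: in_set_conv_nth pole_count p_def nth_real_pole_def)
    have "q \<le> p (Suc j) (n + Suc j)"
      using mono[of l "n + j" "Suc j"] l by (cases "l = n + j") auto
    then show ?thesis using q False by simp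
  qed
  show ?thesis
    using a b1 b2 c1 c2 c3 d1 d2 by blast
qed

end
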